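(* There exists a universal constant $\xi>0$ such that if $k=k(n)$ and $p=p(n)>0$ satisfy $k=\omega(\log n)$ and $\frac{n}{k}\ge p\binom{n-1}{k-1}=\omega(\log^3 n)$, then with high probability $G^k(n,p)$ is $\xi$-expanding.
   Context: $G^k(n,p)$ is the random $k$-uniform hypergraph on vertex set $[n]$ in which each $k$-subset of $[n]$ is an edge independently with probability $p$. "With high probability" means with probability tending to $1$ as $n\to\infty$; asymptotic notation is as $n\to\infty$. Distance in a $k$-graph $G$: for distinct vertices $x,y$, $\mathrm{dist}(x,y)$ is the smallest $t$ such that there are edges $e_1,\dots,e_t$ with $x\in e_1$, $y\in e_t$ and $e_i\cap e_{i+1}\ne\emptyset$; $\mathrm{dist}(x,x)=0$; for vertex sets $\mathrm{dist}(A,A')=\min_{u\in A,v\in A'}\mathrm{dist}(u,v)$ (edges regarded as vertex sets). $N_V^r(A)=\{v:\mathrm{dist}(A,v)\le r\}$ ($r\in\mathbb{N}_0$), $N_E^r(A)=\{e\in E(G):\mathrm{dist}(e,A)\le r-1\}$ ($r\in\mathbb{N}$), $V_B=\bigcup_{e\in B}e$ and $N_V^r(B)=N_V^r(V_B)$ for $B\subseteq E(G)$. Average vertex degree $d(G)=\frac1{n}\sum_v|N_V^1(v)|$. $\xi$-expanding: Let $G$ be a $k$-graph on $n$ vertices with average vertex degree $d\ge k$ and $0<\xi\le1$. $G$ is $\xi$-expanding if: (A.1) for every vertex $v$ and $r\in\mathbb{N}$ with $d^r\le\sqrt{nk}$, $|N_E^r(v)|\le\frac1\xi\frac{d^r}{k}$;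 (A.2) for every $A\subseteq V(G)$, $r\in\mathbb{N}$, $\xi\min\{|A|d^r,n\}\le|N_V^r(A)|\le\frac1\xi|A|d^r$; (A.3) for every $B\subseteq E(G)$, $r\in\mathbb{N}$, $\xi\min\{|B|kd^r,n\}\le|N_V^r(B)|$. *)

theory Defs
  imports "HOL-Probability.Probability" "HOL-Library.Landau_Symbols" "HOL-Library.Extended_Nat"
begin

text \<open>A hypergraph is given by its vertex set \<open>V\<close> and its set \<open>E\<close> of edges.\<close>

definition k_graph :: "nat \<Rightarrow> 'a set \<Rightarrow> 'a set set \<Rightarrow> bool" where
  "k_graph k V E \<longleftrightarrow> finite V \<and> (\<forall>e\<in>E. e \<subseteq> V \<and> card e = k)"

definition edge_walk :: "'a set set \<Rightarrow> 'a \<Rightarrow> 'a \<Rightarrow> 'a set list \<Rightarrow> bool" where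
  "edge_walk E x y es \<longleftrightarrow>
     es \<noteq> [] \<and> set es \<subseteq> E \<and> x \<in> hd es \<and> y \<in> last es \<and>
     (\<forall>i. Suc i < length es \<longrightarrow> es ! i \<inter> es ! Suc i \<noteq> {})"

text \<open>The infimum is taken in \<^typ>\<open>enat\<close>, so vertices that are not joined by any sequence of edges
  have distance \<open>\<infinity>\<close>, and so does any pair of vertex sets one of which is empty.\<close>

definition vdist :: "'a set set \<Rightarrow> 'a \<Rightarrow> 'a \<Rightarrow> enat" where
  "vdist E x y = (if x = y then 0 else (INF es\<in>{es. edge_walk E x y es}. enat (length es)))"

definition set_dist :: "'a set set \<Rightarrow> 'a set \<Rightarrow> 'a set \<Rightarrow> enat" where
  "set_dist E A A' = (INF u\<in>A. INF v\<in>A'. vdist E u v)"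

definition NV :: "'a set \<Rightarrow> 'a set set \<Rightarrow> nat \<Rightarrow> 'a set \<Rightarrow> 'a set" where
  "NV V E r A = {v \<in> V. set_dist E A {v} \<le> enat r}"

text \<open>Only meaningful for \<open>r \<ge> 1\<close>.\<close>

definition NE :: "'a set set \<Rightarrow> nat \<Rightarrow> 'a set \<Rightarrow> 'a set set" where
  "NE E r A = {e \<in> E. set_dist E e A \<le> enat (r - 1)}"

text \<open>A vertex belongs to its own neighbourhood \<open>NV V E 1 {v}\<close> and is therefore counted here.\<close>

definition avg_degree :: "'a set \<Rightarrow> 'a set set \<Rightarrow> real" where
  "avg_degree V E = (\<Sum>v\<in>V. real (card (NV V E 1 {v}))) / real (card V)"

text \<open>The standing assumptions of the notion (\<open>k\<close>-graph, average degree at least \<open>k\<close>,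
  \<open>0 < \<xi> \<le> 1\<close>) are part of the predicate.\<close>

definition expanding :: "real \<Rightarrow> nat \<Rightarrow> 'a set \<Rightarrow> 'a set set \<Rightarrow> bool" where
  "expanding \<xi> k V E \<longleftrightarrow>
     (let n = real (card V); d = avg_degree V E in
       k_graph k V E \<and> real k \<le> d \<and> 0 < \<xi> \<and> \<xi> \<le> 1 \<and>
       (\<forall>v\<in>V. \<forall>r\<ge>1. d ^ r \<le> sqrt (n * real k) \<longrightarrow>
          real (card (NE E r {v})) \<le> 1 / \<xi> * (d ^ r / real k)) \<and>
       (\<forall>A\<subseteq>V. \<forall>r\<ge>1.
          \<xi> * min (real (card A) * d ^ r) n \<le> real (card (NV V E r A)) \<and>
          real (card (NV V E r A)) \<le> 1 / \<xi> * real (card A) * d ^ r) \<and>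
       (\<forall>B\<subseteq>E. \<forall>r\<ge>1.
          \<xi> * min (real (card B) * real k * d ^ r) n \<le> real (card (NV V E r (\<Union>B)))))"

text \<open>The edge set of the random hypergraph \<open>G\<^sup>k(n,p)\<close> on the vertex set \<open>{1..n}\<close>: one independent
  Bernoulli variable for each potential edge.\<close>

definition random_hypergraph :: "nat \<Rightarrow> nat \<Rightarrow> real \<Rightarrow> nat set set pmf" where
  "random_hypergraph k n p =
     (let S = {e. e \<subseteq> {1..n} \<and> card e = k} in
       map_pmf (\<lambda>f. {e \<in> S. f e}) (Pi_pmf S False (\<lambda>_. bernoulli_pmf p)))"

end

theory Submission
  imports Defs
begin

text \<open>
  Write \<open>L = ln n\<close>, \<open>D = p * ((n-1) choose (k-1))\<close> and \<open>R = k * D\<close>. A monotone function of independent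
  Bernoulli variables that each change it by at most \<open>c\<^sub>e\<close> satisfies a sub-Gaussian bound with variance proxy
  \<open>p * \<Sum>c\<^sub>e\<^sup>2\<close>. Applied to the number of vertices covered by the edges that meet a fixed set \<open>A\<close>, whose mean
  is at least \<open>|A| R (1 - |A| R / 2n - 1/L)\<close>, it bounds the probability of a shortfall by \<open>|A| R / L\<close> by
  \<open>exp (- |A| D / 4L\<^sup>2) \<le> n\<^bsup>-3|A|\<^esup>\<close>, which survives the union bound over \<open>A\<close>; this is where \<open>D = \<omega>(L\<^sup>3)\<close> is used.
  The same bound keeps all degrees below \<open>(1 + 1/L) D\<close>, and a first moment computation shows that any \<open>b \<le> n/k\<close>
  edges span at least \<open>bk/10\<close> vertices, where \<open>k = \<omega>(L)\<close> is used.

  These three properties imply expansion. Each step multiplies the size of a neighbourhood by a factor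
  between \<open>(1 - 4/L) R\<close> and \<open>(1 + 1/L) R\<close> until it reaches order \<open>n/L\<close>, which takes at most \<open>L\<close> steps, so that
  the error factors multiply up to a constant; two more steps, each losing a constant factor, reach a
  positive fraction of all vertices.
\<close>

section \<open>Concentration for independent Bernoulli variables\<close>

text \<open>The range includes arbitrarily negative \<open>x\<close>, because the lower tail below
  uses a negative exponent parameter of any size.\<close>

lemma exp_le_quadratic:
  fixes x :: real
  assumes "x \<le> 1"
  shows "exp x \<le> 1 + x + x\<^sup>2"
proof (cases "0 \<le> x")
  case True
  then show ?thesis using assms exp_bound by blast
next
  case False
  show ?thesis
  proof (cases "x \<le> -1")
    case True
    then have "exp x \<le> 1" "x * (x + 1) \<ge> 0" by (auto intro: mult_nonpos_nonpos)
    then show ?thesis by (unfold power2_eq_square distrib_left, linarith)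
  next
    case F: False
    have "exp (-x) \<ge> 1 - x" using exp_ge_add_one_self[of "-x"] by simp
    then have "exp x \<le> 1 / (1 - x)"
      using False by (simp add: exp_minus field_simps)
    also have "\<dots> \<le> 1 + x + x\<^sup>2"
    proof -
      have "x\<^sup>2 * x \<le> 0" using False by (intro mult_nonneg_nonpos) auto
      \<comment> \<open>The product is \<open>1 - x ^ 3\<close>, and \<open>x\<close> is negative
        here.\<close>
      then have "1 \<le> (1 + x + x\<^sup>2) * (1 - x)" by (simp add: algebra_simps power2_eq_square)
      then show ?thesis using False by (simp add: divide_le_eq)
    qed
    finally show ?thesis .
  qed
qed

text \<open>The single-coordinate case of the concentration bound. The factor \<open>p\<close> in
  the variance term, in place of the constant of Hoeffding's lemma, is what makes the bound
  effective for small \<open>p\<close>.\<close>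

lemma two_point_mgf:
  fixes p a b c l :: real
  assumes "0 \<le> p" "p \<le> 1" "0 \<le> b - a" "b - a \<le> c" "l * c \<le> 1"
  shows "p * exp (l * b) + (1 - p) * exp (l * a) \<le> exp (l * (p * b + (1 - p) * a) + p * l\<^sup>2 * c\<^sup>2)"
proof -
  define x where "x = l * (b - a)"
  have "x \<le> 1"
  proof (cases "0 \<le> l")
    case True
    then have "x \<le> l * c" unfolding x_def using assms by (intro mult_left_mono) auto
    then show ?thesis using assms by simp
  next
    case False
    then have "x \<le> 0" unfolding x_def using assms by (intro mult_nonpos_nonneg) auto
    then show ?thesis by simp
  qed
  have x2: "x\<^sup>2 \<le> l\<^sup>2 * c\<^sup>2"
    unfolding x_def power_mult_distrib using assms by (intro mult_left_mono power_mono) auto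
  have "p * exp (l * b) + (1 - p) * exp (l * a) = exp (l * a) * (1 + p * (exp x - 1))"
    unfolding x_def by (simp add: algebra_simps flip: exp_add)
  also have "\<dots> \<le> exp (l * a) * (1 + p * (x + x\<^sup>2))"
    using exp_le_quadratic[OF \<open>x \<le> 1\<close>] assms by (intro mult_left_mono add_left_mono) auto
  also have "\<dots> \<le> exp (l * a) * exp (p * (x + x\<^sup>2))"
    by (intro mult_left_mono exp_ge_add_one_self) auto
  also have "\<dots> = exp (l * (p * b + (1 - p) * a) + p * x\<^sup>2)"
    unfolding x_def by (simp add: algebra_simps flip: exp_add)
  also have "\<dots> \<le> exp (l * (p * b + (1 - p) * a) + p * l\<^sup>2 * c\<^sup>2)"
    using x2 assms(1) by (simp add: mult.assoc mult_left_mono)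
  finally show ?thesis .
qed

abbreviation bernoullis :: "'e set \<Rightarrow> real \<Rightarrow> ('e \<Rightarrow> bool) pmf" where
  "bernoullis S p \<equiv> Pi_pmf S False (\<lambda>_. bernoulli_pmf p)"

lemma finite_set_bernoullis: "finite S \<Longrightarrow> finite (set_pmf (bernoullis S p))"
  by (auto simp: set_Pi_pmf intro!: finite_PiE_dflt intro: finite_subset[OF subset_UNIV])

lemma integrable_bernoullis:
  fixes F :: "('e \<Rightarrow> bool) \<Rightarrow> real"
  shows "finite S \<Longrightarrow> integrable (measure_pmf (bernoullis S p)) F"
  by (intro integrable_measure_pmf_finite finite_set_bernoullis)

lemma expectation_bernoullis_insert:
  fixes F :: "('e \<Rightarrow> bool) \<Rightarrow> real"
  assumes "finite S" "e \<notin> S" "0 \<le> p" "p \<le> 1"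
  shows "measure_pmf.expectation (bernoullis (insert e S) p) F =
    p * measure_pmf.expectation (bernoullis S p) (\<lambda>g. F (g(e := True))) +
    (1 - p) * measure_pmf.expectation (bernoullis S p) (\<lambda>g. F (g(e := False)))"
proof -
  have "measure_pmf.expectation (bernoullis (insert e S) p) F =
     measure_pmf.expectation (bernoulli_pmf p \<bind> (\<lambda>y. map_pmf (\<lambda>f. f(e := y)) (bernoullis S p))) F"
    using assms by (subst Pi_pmf_insert') (auto simp: map_pmf_def)
  also have "\<dots> = (\<Sum>y\<in>UNIV. pmf (bernoulli_pmf p) y *\<^sub>R
      measure_pmf.expectation (map_pmf (\<lambda>f. f(e := y)) (bernoullis S p)) F)"
    by (intro pmf_expectation_bind) (auto simp: assms finite_set_bernoullis)
  finally show ?thesis using assms by (simp add: UNIV_bool)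
qed

text \<open>Induction on the coordinates. Conditioning on \<open>e\<close> leaves a function of the
  remaining ones with the same increment bounds, and the two conditional means differ by an amount
  between \<open>0\<close> and \<open>c e\<close>, so \<open>two_point_mgf\<close> combines
  them.\<close>

lemma bernoullis_mgf:
  fixes F :: "('e \<Rightarrow> bool) \<Rightarrow> real" and c :: "'e \<Rightarrow> real"
  assumes "finite S" "0 \<le> p" "p \<le> 1"
    and "\<And>e g. e \<in> S \<Longrightarrow> 0 \<le> F (g(e := True)) - F (g(e := False))"
    and "\<And>e g. e \<in> S \<Longrightarrow> F (g(e := True)) - F (g(e := False)) \<le> c e"
    and "\<And>e. e \<in> S \<Longrightarrow> l * c e \<le> 1"
  shows "measure_pmf.expectation (bernoullis S p) (\<lambda>g. exp (l * F g))
    \<le> exp (l * measure_pmf.expectation (bernoullis S p) F + p * l\<^sup>2 * (\<Sum>e\<in>S. (c e)\<^sup>2))"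
  using assms
proof (induction S arbitrary: F rule: finite_induct)
  case empty
  show ?case by simp
next
  case (insert e S)
  let ?E = "measure_pmf.expectation (bernoullis S p)"
  define s where "s = p * l\<^sup>2 * (\<Sum>e\<in>S. (c e)\<^sup>2)"
  let ?m = "\<lambda>y. ?E (\<lambda>g. F (g(e := y)))"
  have IH: "?E (\<lambda>g. exp (l * F (g(e := y)))) \<le> exp (l * ?m y + s)" for y
    unfolding s_def
  proof (rule insert.IH[OF insert.prems(1,2)])
    fix e' g assume "e' \<in> S"
    then have "e' \<noteq> e" "e' \<in> insert e S" using insert.hyps by auto
    then show "0 \<le> F ((g(e' := True))(e := y)) - F ((g(e' := False))(e := y))"
      "F ((g(e' := True))(e := y)) - F ((g(e' := False))(e := y)) \<le> c e'"
      using insert.prems(3,4)[of e' "g(e := y)"] by (simp_all only: fun_upd_twist[of e' e] simp_thms)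
  next
    fix e' assume "e' \<in> S"
    then show "l * c e' \<le> 1" by (intro insert.prems(5)) simp
  qed
  have int: "integrable (measure_pmf (bernoullis S p)) G" for G :: "_ \<Rightarrow> real"
    by (rule integrable_bernoullis) fact
  have m0: "0 \<le> ?m True - ?m False"
    unfolding Bochner_Integration.integral_diff[OF int int, symmetric]
    by (rule Bochner_Integration.integral_nonneg) (rule insert.prems(3), simp)
  have "?m True - ?m False \<le> ?E (\<lambda>_. c e)"
    unfolding Bochner_Integration.integral_diff[OF int int, symmetric]
    by (rule Bochner_Integration.integral_mono, rule int, rule int, rule insert.prems(4), simp)
  then have mc: "?m True - ?m False \<le> c e" by simp
  have "measure_pmf.expectation (bernoullis (insert e S) p) (\<lambda>g. exp (l * F g))
      = p * ?E (\<lambda>g. exp (l * F (g(e := True)))) + (1 - p) * ?E (\<lambda>g. exp (l * F (g(e := False))))"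
    using insert.hyps insert.prems(1,2) by (simp add: expectation_bernoullis_insert)
  also have "\<dots> \<le> p * exp (l * ?m True + s) + (1 - p) * exp (l * ?m False + s)"
    using insert.prems(1,2) by (intro add_mono mult_left_mono IH) auto
  also have "\<dots> = (p * exp (l * ?m True) + (1 - p) * exp (l * ?m False)) * exp s"
    by (simp add: algebra_simps exp_add)
  also have "\<dots> \<le> exp (l * (p * ?m True + (1 - p) * ?m False) + p * l\<^sup>2 * (c e)\<^sup>2) * exp s"
    using insert.prems(1,2) insert.prems(5)[of e] m0 mc by (intro mult_right_mono two_point_mgf) auto
  also have "\<dots> = exp (l * measure_pmf.expectation (bernoullis (insert e S) p) F
      + p * l\<^sup>2 * (\<Sum>e\<in>insert e S. (c e)\<^sup>2))"
    using insert.hyps insert.prems(1,2)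
    by (simp add: expectation_bernoullis_insert s_def algebra_simps flip: exp_add)
  finally show ?case .
qed

text \<open>Markov's inequality for the exponential moment. The sign of \<open>l\<close> is left
  open, so that both tails are instances.\<close>

lemma bernoullis_tail:
  fixes F :: "('e \<Rightarrow> bool) \<Rightarrow> real" and c :: "'e \<Rightarrow> real"
  assumes "finite S" "0 \<le> p" "p \<le> 1"
    and "\<And>e g. e \<in> S \<Longrightarrow> 0 \<le> F (g(e := True)) - F (g(e := False))"
    and "\<And>e g. e \<in> S \<Longrightarrow> F (g(e := True)) - F (g(e := False)) \<le> c e"
    and "\<And>e. e \<in> S \<Longrightarrow> l * c e \<le> 1"
    and "p * (\<Sum>e\<in>S. (c e)\<^sup>2) \<le> \<mu>"
  shows "measure_pmf.prob (bernoullis S p) {g. u \<le> l * (F g - measure_pmf.expectation (bernoullis S p) F)}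
    \<le> exp (l\<^sup>2 * \<mu> - u)"
proof -
  let ?P = "bernoullis S p"
  let ?m = "measure_pmf.expectation ?P F"
  have "measure_pmf.prob ?P {g. u \<le> l * (F g - ?m)}
      = measure_pmf.prob ?P {g \<in> space ?P. exp (u + l * ?m) \<le> exp (l * F g)}"
    by (simp add: algebra_simps)
  also have "\<dots> \<le> measure_pmf.expectation ?P (\<lambda>g. exp (l * F g)) / exp (u + l * ?m)"
    by (intro integral_Markov_inequality_measure[where A = "{}"] integrable_bernoullis) (auto simp: assms)
  also have "\<dots> \<le> exp (l * ?m + p * l\<^sup>2 * (\<Sum>e\<in>S. (c e)\<^sup>2)) / exp (u + l * ?m)"
    using assms by (intro divide_right_mono bernoullis_mgf) auto
  also have "\<dots> = exp (l\<^sup>2 * (p * (\<Sum>e\<in>S. (c e)\<^sup>2)) - u)"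
    by (simp add: algebra_simps flip: exp_diff)
  also have "\<dots> \<le> exp (l\<^sup>2 * \<mu> - u)"
    using assms(7) by (simp add: mult_left_mono)
  finally show ?thesis .
qed

lemma bernoullis_lower_tail:
  fixes F :: "('e \<Rightarrow> bool) \<Rightarrow> real" and c :: "'e \<Rightarrow> real"
  assumes "finite S" "0 \<le> p" "p \<le> 1"
    and "\<And>e g. e \<in> S \<Longrightarrow> 0 \<le> F (g(e := True)) - F (g(e := False))"
    and "\<And>e g. e \<in> S \<Longrightarrow> F (g(e := True)) - F (g(e := False)) \<le> c e"
    and "\<And>e. e \<in> S \<Longrightarrow> 0 \<le> c e"
    and "p * (\<Sum>e\<in>S. (c e)\<^sup>2) \<le> \<mu>" "0 < \<mu>" "0 \<le> t"
  shows "measure_pmf.prob (bernoullis S p) {g. F g \<le> measure_pmf.expectation (bernoullis S p) F - t}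
    \<le> exp (- t\<^sup>2 / (4 * \<mu>))"
proof (cases "t = 0")
  case False
  let ?m = "measure_pmf.expectation (bernoullis S p) F"
  \<comment> \<open>This minimises \<open>l ^ 2 * \<mu> + l * t\<close>, with value
    \<open>- t ^ 2 / (4 * \<mu>)\<close>. Being negative, it satisfies
    \<open>l * c e \<le> 1\<close> for every deviation \<open>t\<close>.\<close>
  define l where "l = - t / (2 * \<mu>)"
  have l: "l < 0" using assms False by (simp add: l_def)
  have "l * c e \<le> 1" if "e \<in> S" for e
    using mult_nonpos_nonneg[of l "c e"] l assms(6)[OF that] by linarith
  then have "measure_pmf.prob (bernoullis S p) {g. - l * t \<le> l * (F g - ?m)} \<le> exp (l\<^sup>2 * \<mu> - (- l * t))"
    using assms by (intro bernoullis_tail[where c = c]) auto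
  moreover have "- l * t \<le> l * (F g - ?m) \<longleftrightarrow> F g \<le> ?m - t" for g
  proof -
    have "- l * t \<le> l * (F g - ?m) \<longleftrightarrow> l * (- t) \<le> l * (F g - ?m)" by simp
    also have "\<dots> \<longleftrightarrow> F g - ?m \<le> - t" using l by (subst mult_le_cancel_left_neg) auto
    finally show ?thesis by auto
  qed
  moreover have "l\<^sup>2 * \<mu> - (- l * t) = - t\<^sup>2 / (4 * \<mu>)"
    using assms by (simp add: l_def field_simps power2_eq_square)
  ultimately show ?thesis by simp
qed auto

text \<open>For the optimal \<open>l = t / (2 * \<mu>)\<close>, now positive, the condition
  \<open>l * c e \<le> 1\<close> of \<open>bernoullis_tail\<close> restricts the deviation; this is
  the hypothesis on \<open>t * c e\<close>.\<close>

lemma bernoullis_upper_tail: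
  fixes F :: "('e \<Rightarrow> bool) \<Rightarrow> real" and c :: "'e \<Rightarrow> real"
  assumes "finite S" "0 \<le> p" "p \<le> 1"
    and "\<And>e g. e \<in> S \<Longrightarrow> 0 \<le> F (g(e := True)) - F (g(e := False))"
    and "\<And>e g. e \<in> S \<Longrightarrow> F (g(e := True)) - F (g(e := False)) \<le> c e"
    and "\<And>e. e \<in> S \<Longrightarrow> t * c e \<le> 2 * \<mu>"
    and "p * (\<Sum>e\<in>S. (c e)\<^sup>2) \<le> \<mu>" "0 < \<mu>" "0 \<le> t"
  shows "measure_pmf.prob (bernoullis S p) {g. measure_pmf.expectation (bernoullis S p) F + t \<le> F g}
    \<le> exp (- t\<^sup>2 / (4 * \<mu>))"
proof (cases "t = 0")
  case False
  let ?m = "measure_pmf.expectation (bernoullis S p) F"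
  define l where "l = t / (2 * \<mu>)"
  have l: "l > 0" using assms False by (simp add: l_def)
  have "l * c e \<le> 1" if "e \<in> S" for e
    using assms(6)[OF that] assms(8) by (simp add: l_def field_simps)
  then have "measure_pmf.prob (bernoullis S p) {g. l * t \<le> l * (F g - ?m)} \<le> exp (l\<^sup>2 * \<mu> - l * t)"
    using assms by (intro bernoullis_tail[where c = c]) auto
  moreover have "l * t \<le> l * (F g - ?m) \<longleftrightarrow> ?m + t \<le> F g" for g
    using l by (subst mult_le_cancel_left_pos) auto
  moreover have "l\<^sup>2 * \<mu> - l * t = - t\<^sup>2 / (4 * \<mu>)"
    using assms by (simp add: l_def field_simps power2_eq_square)
  ultimately show ?thesis by simp
qed auto

lemma prob_bernoullis_all:
  assumes "finite S" "T \<subseteq> S" "0 \<le> p" "p \<le> 1"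
  shows "measure_pmf.prob (bernoullis S p) {g. \<forall>e\<in>T. g e} = p ^ card T"
    and "measure_pmf.prob (bernoullis S p) {g. \<forall>e\<in>T. \<not> g e} = (1 - p) ^ card T"
proof -
  have *: "measure_pmf.prob (bernoullis S p) {g. \<forall>e\<in>T. g e = b} = pmf (bernoulli_pmf p) b ^ card T" for b
  proof -
    have "measure_pmf.prob (bernoullis S p) {g. \<forall>e\<in>T. g e = b}
      = measure_pmf.prob (bernoullis S p) (Pi S (\<lambda>e. if e \<in> T then {b} else UNIV))"
      using assms by (intro arg_cong[where f = "measure_pmf.prob _"]) (auto simp: Pi_def split: if_splits)
    also have "\<dots> = (\<Prod>e\<in>S. measure_pmf.prob (bernoulli_pmf p) (if e \<in> T then {b} else UNIV))"
      by (rule measure_Pi_pmf_Pi) fact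
    also have "\<dots> = (\<Prod>e\<in>T. pmf (bernoulli_pmf p) b)"
      using assms by (intro prod.mono_neutral_cong_right) (auto simp: measure_pmf_single)
    finally show ?thesis by simp
  qed
  from *[of True] *[of False] show "measure_pmf.prob (bernoullis S p) {g. \<forall>e\<in>T. g e} = p ^ card T"
    "measure_pmf.prob (bernoullis S p) {g. \<forall>e\<in>T. \<not> g e} = (1 - p) ^ card T"
    using assms by auto
qed

section \<open>Binomial coefficients and elementary estimates\<close>

lemma binomial_Pascal: "0 < N \<Longrightarrow> 0 < j \<Longrightarrow> N choose j = ((N - 1) choose (j - 1)) + ((N - 1) choose j)"
  by (cases N; cases j) auto

text \<open>The difference of the two binomials counts the \<open>j\<close>-subsets of an
  \<open>m\<close>-set that meet a fixed \<open>a\<close>-set. This is the union bound over the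
  \<open>a\<close> points, proved by removing one point at a time.\<close>

lemma binomial_diff_le:
  assumes "0 < j" "a \<le> m"
  shows "m choose j \<le> ((m - a) choose j) + a * ((m - 1) choose (j - 1))"
  using assms(2)
proof (induction a)
  case (Suc a)
  have "m - a choose j = ((m - a - 1) choose (j - 1)) + ((m - a - 1) choose j)"
    using Suc.prems assms by (intro binomial_Pascal) auto
  moreover have "(m - a - 1) choose (j - 1) \<le> (m - 1) choose (j - 1)"
    by (intro binomial_right_mono) auto
  ultimately show ?case using Suc by simp
qed simp

lemma real_binomial_absorb:
  assumes "0 < j"
  shows "real N * real ((N - 1) choose (j - 1)) = real j * real (N choose j)"
  using times_binomial_minus1_eq[OF assms, of N] by (metis of_nat_mult)

text \<open>Counterpart of \<open>binomial_diff_le\<close> with a second-order correction. By that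
  lemma one level down, each Pascal term \<open>(m - 1 - a) choose (j - 1)\<close> falls short of
  \<open>(m - 1) choose (j - 1)\<close> by a relative amount of at most
  \<open>a * (j - 1) / (m - 1)\<close>.\<close>

lemma binomial_diff_ge:
  assumes "0 < j" "a < m"
  shows "real a * real ((m - 1) choose (j - 1)) * (1 - real a * (real j - 1) / (real m - 1))
    \<le> real (m choose j) - real ((m - a) choose j)"
  using assms(2)
proof (induction a)
  case (Suc a)
  define c where "c = real ((m - 1) choose (j - 1))"
  define x where "x = (real j - 1) / (real m - 1)"
  have x0: "0 \<le> x" unfolding x_def using assms Suc.prems by auto
  have "c \<le> real ((m - 1 - a) choose (j - 1)) + real a * (c * x)"
  proof (cases "j = 1")
    case False
    have "(m - 1) choose (j - 1) \<le> ((m - 1 - a) choose (j - 1)) + a * ((m - 1 - 1) choose (j - 1 - 1))"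
      using False assms Suc.prems by (intro binomial_diff_le) auto
    then have "c \<le> real ((m - 1 - a) choose (j - 1)) + real a * real ((m - 1 - 1) choose (j - 1 - 1))"
      unfolding c_def by (metis of_nat_add of_nat_le_iff of_nat_mult)
    moreover have "real ((m - 1 - 1) choose (j - 1 - 1)) = c * x"
    proof -
      have "real (m - 1) * real ((m - 1 - 1) choose (j - 1 - 1)) = real (j - 1) * c"
        using real_binomial_absorb[of "j - 1" "m - 1"] False assms by (simp add: c_def)
      then show ?thesis using Suc.prems assms by (auto simp: x_def field_simps of_nat_diff)
    qed
    ultimately show ?thesis by simp
  qed (simp add: x_def c_def)
  then have step: "c * (1 - real a * x) \<le> real ((m - 1 - a) choose (j - 1))" by (simp add: algebra_simps)
  have "m - a choose j = ((m - a - 1) choose (j - 1)) + ((m - a - 1) choose j)"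
    using Suc.prems assms by (intro binomial_Pascal) auto
  then have eq: "real (m - Suc a choose j) = real (m - a choose j) - real ((m - 1 - a) choose (j - 1))"
    by (simp add: diff_commute)
  have c0: "0 \<le> c" by (simp add: c_def)
  \<comment> \<open>Relaxing the correction from \<open>Suc a\<close> to \<open>a\<close> lets the
    product split into the induction hypothesis and the new Pascal term.\<close>
  have "real (Suc a) * c * (1 - real (Suc a) * x) \<le> real (Suc a) * c * (1 - real a * x)"
    using x0 c0 by (intro mult_left_mono) (auto simp: algebra_simps)
  also have "\<dots> = real a * c * (1 - real a * x) + c * (1 - real a * x)" by (simp add: algebra_simps)
  also have "\<dots> \<le> (real (m choose j) - real (m - a choose j)) + real ((m - 1 - a) choose (j - 1))"
    using Suc step by (intro add_mono) (auto simp: c_def x_def)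
  finally show ?case using eq by (simp add: c_def x_def)
qed simp

text \<open>The quotient of the two binomials is a product of factors
  \<open>(s - i) / (n - i)\<close>, each at most \<open>s / n\<close>.\<close>

lemma binomial_le_ratio_power:
  assumes "s \<le> n"
  shows "real (s choose k) \<le> real (n choose k) * (real s / real n) ^ k"
proof (induction k)
  case (Suc k)
  show ?case
  proof (cases "k < s")
    case True
    have rec: "real (N choose Suc k) = real (N choose k) * (real N - real k) / (real k + 1)" if "k < N" for N
    proof -
      have "Suc k * (N choose Suc k) = (N - k) * (N choose k)"
        using binomial_absorb_comp[of N k] times_binomial_minus1_eq[of "Suc k" N] by simp
      then have "real (Suc k) * real (N choose Suc k) = real (N - k) * real (N choose k)"
        by (metis of_nat_mult)
      then show ?thesis using that by (simp add: field_simps of_nat_diff)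
    qed
    have q: "real s - real k \<le> real s / real n * (real n - real k)"
    proof -
      have "real s * real k \<le> real n * real k" using assms by (intro mult_right_mono) auto
      then show ?thesis using True assms by (simp add: field_simps)
    qed
    have "real (s choose k) * (real s - real k)
        \<le> (real (n choose k) * (real s / real n) ^ k) * (real s / real n * (real n - real k))"
      using Suc.IH q True by (intro mult_mono) auto
    then have "real (s choose k) * (real s - real k) / (real k + 1)
        \<le> (real (n choose k) * (real s / real n) ^ k) * (real s / real n * (real n - real k)) / (real k + 1)"
      by (rule divide_right_mono) simp
    then show ?thesis using True assms by (simp add: rec mult_ac)
  qed (simp add: binomial_eq_0)
qed simp

text \<open>After \<open>(n choose s) \<le> n ^ s / fact s\<close> there remains
  \<open>s ^ s / fact s\<close>, a single term of the series of \<open>exp s\<close>. The bound pays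
  for a union over vertex sets of size \<open>s\<close>.\<close>

lemma binomial_times_power_le_exp:
  assumes "0 < n"
  shows "real (n choose s) * (real s / real n) ^ s \<le> exp (real s)"
proof -
  have "real (n choose s) * fact s \<le> real n ^ s"
    using binomial_fact_pow[of n s] by (metis of_nat_fact of_nat_le_iff of_nat_mult of_nat_power)
  then have "real (n choose s) \<le> real n ^ s / fact s" by (simp add: field_simps)
  then have "real (n choose s) * (real s / real n) ^ s \<le> real n ^ s / fact s * (real s / real n) ^ s"
    by (intro mult_right_mono) auto
  also have "\<dots> = real s ^ s / fact s" using assms by (simp add: power_divide)
  also have "\<dots> \<le> exp (real s)"
  proof -
    have "(\<Sum>i\<in>{s}. inverse (fact i) * real s ^ i) \<le> (\<Sum>i. inverse (fact i) * real s ^ i)"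
      by (intro sum_le_suminf summable_exp) auto
    then show ?thesis by (simp add: exp_def divide_inverse mult.commute)
  qed
  finally show ?thesis .
qed

section \<open>Counting potential edges\<close>

lemma card_subsets_containing:
  assumes "finite W" "v \<notin> W" "0 < k"
  shows "card {e. e \<subseteq> insert v W \<and> card e = k \<and> v \<in> e} = card W choose (k - 1)"
proof -
  have "bij_betw (insert v) {e. e \<subseteq> W \<and> card e = k - 1} {e. e \<subseteq> insert v W \<and> card e = k \<and> v \<in> e}"
  proof (rule bij_betw_byWitness[where f' = "\<lambda>e. e - {v}"])
    show "insert v ` {e. e \<subseteq> W \<and> card e = k - 1} \<subseteq> {e. e \<subseteq> insert v W \<and> card e = k \<and> v \<in> e}"
    proof
      fix y assume "y \<in> insert v ` {e. e \<subseteq> W \<and> card e = k - 1}"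
      then obtain e where e: "y = insert v e" "e \<subseteq> W" "card e = k - 1" by blast
      then have "finite e" "v \<notin> e" using assms finite_subset by auto
      then show "y \<in> {e. e \<subseteq> insert v W \<and> card e = k \<and> v \<in> e}" using e assms by auto
    qed
    show "(\<lambda>e. e - {v}) ` {e. e \<subseteq> insert v W \<and> card e = k \<and> v \<in> e} \<subseteq> {e. e \<subseteq> W \<and> card e = k - 1}"
      by auto
  qed (use assms in auto)
  from bij_betw_same_card[OF this] show ?thesis using n_subsets[OF assms(1), of "k - 1"] by simp
qed

text \<open>Counts the potential edges through which a vertex \<open>v\<close> outside
  \<open>A\<close> can enter the cover of \<open>A\<close>.\<close>

lemma card_subsets_containing_meeting:
  assumes "finite V" "A \<subseteq> V" "v \<in> V" "v \<notin> A" "0 < k"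
  shows "card {e. e \<subseteq> V \<and> card e = k \<and> v \<in> e \<and> e \<inter> A \<noteq> {}}
    = ((card V - 1) choose (k - 1)) - ((card V - 1 - card A) choose (k - 1))"
proof -
  let ?X = "{e. e \<subseteq> V \<and> card e = k \<and> v \<in> e}"
  let ?Y = "{e. e \<subseteq> V - A \<and> card e = k \<and> v \<in> e}"
  have "finite A" using assms finite_subset by blast
  have "insert v (V - {v}) = V" "insert v (V - A - {v}) = V - A" using assms by auto
  then have "card ?X = card (V - {v}) choose (k - 1)" "card ?Y = card (V - A - {v}) choose (k - 1)"
    using card_subsets_containing[of "V - {v}" v k] card_subsets_containing[of "V - A - {v}" v k] assms
    by auto
  moreover have "card (V - {v}) = card V - 1" "card (V - A - {v}) = card V - 1 - card A"
    using assms \<open>finite A\<close> by (auto simp: card_Diff_subset)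
  moreover have "{e. e \<subseteq> V \<and> card e = k \<and> v \<in> e \<and> e \<inter> A \<noteq> {}} = ?X - ?Y" by auto
  moreover have "card (?X - ?Y) = card ?X - card ?Y"
    using assms by (intro card_Diff_subset) (auto intro: finite_subset[of _ "Pow V"])
  ultimately show ?thesis by simp
qed

text \<open>The product of the right-hand side with the Taylor bound
  \<open>1 + x + x ^ 2 / 2\<close> of \<open>exp x\<close> is \<open>1 + x ^ 4 / 4\<close>.\<close>

lemma exp_minus_le_quadratic:
  fixes x :: real
  assumes "0 \<le> x"
  shows "exp (- x) \<le> 1 - x + x\<^sup>2 / 2"
proof -
  have "1 \<le> (1 - x + x\<^sup>2 / 2) * (1 + x + x\<^sup>2 / 2)"
  proof -
    have "(1 - x + x\<^sup>2 / 2) * (1 + x + x\<^sup>2 / 2) = 1 + (x\<^sup>2)\<^sup>2 / 4"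
      by (simp add: algebra_simps power2_eq_square)
    then show ?thesis by simp
  qed
  also have "\<dots> \<le> (1 - x + x\<^sup>2 / 2) * exp x"
  proof (rule mult_left_mono)
    show "1 + x + x\<^sup>2 / 2 \<le> exp x" using exp_lower_Taylor_quadratic[OF assms] by simp
    have "0 \<le> (x - 1)\<^sup>2" by simp
    then show "0 \<le> 1 - x + x\<^sup>2 / 2" by (simp add: power2_eq_square algebra_simps)
  qed
  finally show ?thesis by (simp add: exp_minus field_simps)
qed

text \<open>A Bonferroni-type lower bound for the probability that one of \<open>m\<close>
  independent events of probability \<open>p\<close> occurs; the events will be the potential edges
  joining a vertex to \<open>A\<close>.\<close>

lemma one_minus_power_le:
  fixes p :: real
  assumes "0 \<le> p" "p \<le> 1"
  shows "real m * p - (real m * p)\<^sup>2 / 2 \<le> 1 - (1 - p) ^ m"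
proof -
  have "(1 - p) ^ m \<le> exp (- p) ^ m"
    using assms exp_ge_add_one_self[of "- p"] by (intro power_mono) auto
  also have "\<dots> = exp (- (real m * p))" by (simp flip: exp_of_nat_mult)
  also have "\<dots> \<le> 1 - real m * p + (real m * p)\<^sup>2 / 2" using assms by (intro exp_minus_le_quadratic) auto
  finally show ?thesis by simp
qed

lemma prob_UN_le:
  assumes "finite I" "\<And>i. i \<in> I \<Longrightarrow> measure_pmf.prob M (X i) \<le> c"
  shows "measure_pmf.prob M (\<Union>i\<in>I. X i) \<le> real (card I) * c"
proof -
  have "measure_pmf.prob M (\<Union>i\<in>I. X i) \<le> (\<Sum>i\<in>I. measure_pmf.prob M (X i))"
    using assms by (intro measure_pmf.finite_measure_subadditive_finite) auto
  also have "\<dots> \<le> (\<Sum>i\<in>I. c)" by (intro sum_mono assms)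
  finally show ?thesis by simp
qed

section \<open>Neighbourhoods in hypergraphs\<close>

text \<open>In \<open>enat\<close> a nonempty infimum is attained, and the empty one is \<infinity>,
  which is below no \<open>enat r\<close>.\<close>

lemma INF_enat_le_iff: "(INF x\<in>A. f x) \<le> enat r \<longleftrightarrow> (\<exists>x\<in>A. f x \<le> enat r)"
proof
  assume le: "(INF x\<in>A. f x) \<le> enat r"
  then have "A \<noteq> {}" by (auto simp: top_enat_def)
  then have "(INF x\<in>A. f x) \<in> f ` A"
    unfolding Inf_enat_def by (auto intro: LeastI)
  then show "\<exists>x\<in>A. f x \<le> enat r" using le by auto
next
  assume "\<exists>x\<in>A. f x \<le> enat r"
  then show "(INF x\<in>A. f x) \<le> enat r" by (auto intro: INF_lower2)
qed

lemma vdist_le_iff: "vdist E x y \<le> enat r \<longleftrightarrow> x = y \<or> (\<exists>es. edge_walk E x y es \<and> length es \<le> r)"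
  by (auto simp: vdist_def INF_enat_le_iff)

lemma set_dist_le_iff: "set_dist E A B \<le> enat r \<longleftrightarrow> (\<exists>u\<in>A. \<exists>v\<in>B. vdist E u v \<le> enat r)"
  by (simp add: set_dist_def INF_enat_le_iff)

lemma edge_walk_rev: "edge_walk E x y es \<Longrightarrow> edge_walk E y x (rev es)"
  unfolding edge_walk_def
proof (intro conjI allI impI; (elim conjE)?)
  fix i assume s: "Suc i < length (rev es)" and c: "\<forall>i. Suc i < length es \<longrightarrow> es ! i \<inter> es ! Suc i \<noteq> {}"
  define j where "j = length es - Suc (Suc i)"
  have "Suc j < length es" "rev es ! i = es ! Suc j" "rev es ! Suc i = es ! j"
    using s by (auto simp: rev_nth j_def Suc_diff_Suc)
  then show "rev es ! i \<inter> rev es ! Suc i \<noteq> {}" using c by auto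
qed (auto simp: hd_rev last_rev)

lemma vdist_commute: "vdist E x y = vdist E y x"
proof -
  have "vdist E x y \<le> enat r \<Longrightarrow> vdist E y x \<le> enat r" for x y r
    unfolding vdist_le_iff using edge_walk_rev by force
  then show ?thesis
    by (metis antisym enat_ord_code(3) not_infinity_eq order_refl)
qed

lemma edge_walk_singleton: "edge_walk E x y [e] \<longleftrightarrow> e \<in> E \<and> x \<in> e \<and> y \<in> e"
  by (auto simp: edge_walk_def)

text \<open>A common vertex \<open>w\<close> of the last two edges becomes the end point of the
  shorter walk.\<close>

lemma edge_walk_snoc:
  assumes "es \<noteq> []"
  shows "edge_walk E x y (es @ [e]) \<longleftrightarrow> e \<in> E \<and> y \<in> e \<and> (\<exists>w\<in>e. edge_walk E x w es)"
proof
  assume w: "edge_walk E x y (es @ [e])"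
  then have "(es @ [e]) ! (length es - 1) \<inter> (es @ [e]) ! Suc (length es - 1) \<noteq> {}"
    using assms unfolding edge_walk_def by (metis One_nat_def Suc_pred length_append_singleton length_greater_0_conv lessI)
  then obtain w where "w \<in> last es" "w \<in> e" using assms by (auto simp: nth_append last_conv_nth)
  moreover have "es ! i \<inter> es ! Suc i \<noteq> {}" if "Suc i < length es" for i
    using w that unfolding edge_walk_def by (auto simp: nth_append dest!: spec[of _ i])
  ultimately show "e \<in> E \<and> y \<in> e \<and> (\<exists>w\<in>e. edge_walk E x w es)"
    using w assms by (auto simp: edge_walk_def)
next
  assume "e \<in> E \<and> y \<in> e \<and> (\<exists>w\<in>e. edge_walk E x w es)"
  then obtain w where w: "e \<in> E" "y \<in> e" "w \<in> e" "edge_walk E x w es" by auto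
  have "(es @ [e]) ! i \<inter> (es @ [e]) ! Suc i \<noteq> {}" if "Suc i < length (es @ [e])" for i
  proof (cases "Suc i < length es")
    case True
    then show ?thesis using w by (auto simp: edge_walk_def nth_append)
  next
    case False
    then have "i = length es - 1" using that by auto
    then show ?thesis using w assms by (auto simp: edge_walk_def nth_append last_conv_nth)
  qed
  then show "edge_walk E x y (es @ [e])" using w assms by (auto simp: edge_walk_def)
qed

text \<open>Vertices of \<open>A\<close> that lie in no edge are missing from the cover, hence the
  union with the previous neighbourhood in \<open>NV_Suc\<close>.\<close>

definition cover :: "'a set set \<Rightarrow> 'a set \<Rightarrow> 'a set" where
  "cover E A = \<Union>{e \<in> E. e \<inter> A \<noteq> {}}"

lemma NV_0: "A \<subseteq> V \<Longrightarrow> NV V E 0 A = A"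
  by (auto simp: NV_def set_dist_le_iff vdist_le_iff edge_walk_def)

text \<open>Replaces walks by iteration: all later estimates treat a neighbourhood as
  \<open>r\<close> applications of one covering step.\<close>

lemma NV_Suc:
  assumes "\<Union>E \<subseteq> V" "A \<subseteq> V"
  shows "NV V E (Suc r) A = NV V E r A \<union> cover E (NV V E r A)"
proof (intro set_eqI iffI)
  fix v assume v: "v \<in> NV V E (Suc r) A"
  then obtain u where u: "u \<in> A" "vdist E u v \<le> enat (Suc r)" and "v \<in> V"
    by (auto simp: NV_def set_dist_le_iff)
  have u_in: "u \<in> NV V E r A" using u assms by (auto simp: NV_def set_dist_le_iff vdist_le_iff)
  show "v \<in> NV V E r A \<union> cover E (NV V E r A)"
  proof (cases "u = v")
    case True
    then show ?thesis using u_in by auto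
  next
    case False
    then obtain es where es: "edge_walk E u v es" "length es \<le> Suc r"
      using u by (auto simp: vdist_le_iff)
    then obtain es' e where "es = es' @ [e]" by (cases es rule: rev_cases) (auto simp: edge_walk_def)
    show ?thesis
    proof (cases "es' = []")
      case True
      then show ?thesis using es u_in \<open>es = es' @ [e]\<close> by (auto simp: edge_walk_singleton cover_def)
    next
      case False
      then obtain w where "e \<in> E" "v \<in> e" "w \<in> e" "edge_walk E u w es'"
        using es \<open>es = es' @ [e]\<close> edge_walk_snoc by metis
      moreover have "length es' \<le> r" using es \<open>es = es' @ [e]\<close> by simp
      ultimately have "w \<in> NV V E r A"
        using u assms by (auto simp: NV_def set_dist_le_iff vdist_le_iff)
      then show ?thesis using \<open>e \<in> E\<close> \<open>v \<in> e\<close> \<open>w \<in> e\<close> by (auto simp: cover_def)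
    qed
  qed
next
  fix v assume "v \<in> NV V E r A \<union> cover E (NV V E r A)"
  then show "v \<in> NV V E (Suc r) A"
  proof
    assume "v \<in> NV V E r A"
    then show ?thesis
      by (auto simp: NV_def elim!: order_trans)
  next
    assume "v \<in> cover E (NV V E r A)"
    then obtain e w where e: "e \<in> E" "v \<in> e" "w \<in> e" "w \<in> NV V E r A" by (auto simp: cover_def)
    then obtain u where u: "u \<in> A" "vdist E u w \<le> enat r" by (auto simp: NV_def set_dist_le_iff)
    have "vdist E u v \<le> enat (Suc r)"
    proof (cases "u = w")
      case True
      then have "edge_walk E u v [e]" using e by (simp add: edge_walk_singleton)
      then show ?thesis unfolding vdist_le_iff by force
    next
      case False
      then obtain es where es: "edge_walk E u w es" "length es \<le> r" using u by (auto simp: vdist_le_iff)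
      then have "es \<noteq> []" by (auto simp: edge_walk_def)
      then have "edge_walk E u v (es @ [e])" using e es edge_walk_snoc by metis
      then show ?thesis unfolding vdist_le_iff using es by force
    qed
    then show ?thesis using u e assms by (auto simp: NV_def set_dist_le_iff)
  qed
qed

lemma NV_subset: "NV V E r A \<subseteq> V"
  by (auto simp: NV_def)

lemma NV_mono:
  assumes "\<Union>E \<subseteq> V" "A \<subseteq> V" "r \<le> s"
  shows "NV V E r A \<subseteq> NV V E s A"
  using assms(3) by (induction rule: dec_induct) (auto simp: NV_Suc[OF assms(1,2)])

lemma NV_empty: "NV V E r {} = {}"
  by (auto simp: NV_def set_dist_def top_enat_def)

text \<open>Reduces (A.1) to vertex neighbourhoods of radius one smaller; the shift comes from the
  offset \<open>r - 1\<close> in \<open>NE\<close>.\<close>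

lemma NE_Suc_singleton:
  assumes "\<Union>E \<subseteq> V"
  shows "NE E (Suc r) {v} = {e \<in> E. e \<inter> NV V E r {v} \<noteq> {}}"
  using assms by (auto simp: NE_def NV_def set_dist_le_iff vdist_commute[of E v])

section \<open>Expansion from local growth\<close>

text \<open>Used with \<open>x = 4 / L\<close>: at most \<open>L\<close> factors
  \<open>1 - 4 / L\<close> still multiply to at least \<open>exp (-8)\<close>.\<close>

lemma exp_minus_two_le:
  fixes x :: real
  assumes "0 \<le> x" "x \<le> 1/2"
  shows "exp (- 2 * x) \<le> 1 - x"
proof -
  have "- x - 2 * x\<^sup>2 \<le> ln (1 - x)" using assms by (intro ln_one_minus_pos_lower_bound) auto
  moreover have "2 * x\<^sup>2 \<le> x"
    using mult_right_mono[of "2 * x" 1 x] assms by (simp add: power2_eq_square)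
  ultimately have "- 2 * x \<le> ln (1 - x)" by simp
  then have "exp (- 2 * x) \<le> exp (ln (1 - x))" by (subst exp_le_cancel_iff)
  then show ?thesis using assms by simp
qed

text \<open>The bound on \<open>D\<close> makes the deviation exponent
  \<open>D / (4 * L ^ 2)\<close> at least \<open>3 * L\<close>; the bound on \<open>k\<close> lets
  the exponent of the first moment computation absorb \<open>2 * L\<close> per edge;
  \<open>32\<close> is a convenient threshold.\<close>

locale expansion_parameters =
  fixes k n :: nat and D L :: real
  assumes n_eq: "exp L = real n" and L_ge: "32 \<le> L"
    and D_ge: "12 * L ^ 3 \<le> D" and k_ge: "4 * L \<le> real k" and R_le: "real k * D \<le> real n"
begin

definition R :: real where "R = real k * D"

lemma L_pos: "0 < L" using L_ge by simp

lemma D_ge_L: "L \<le> D"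
proof -
  have "1 \<le> L\<^sup>2" by (rule one_le_power) (use L_ge in simp)
  then have "L * 1 \<le> L * (12 * L\<^sup>2)" by (intro mult_left_mono) (use L_pos in linarith)+
  then show ?thesis using D_ge by (simp add: power3_eq_cube power2_eq_square algebra_simps)
qed

lemma D_ge_32: "32 \<le> D" using D_ge_L L_ge by simp

lemma k_ge_128: "128 \<le> real k" using k_ge L_ge by simp

lemma R_ge: "L \<le> R" "32 \<le> R"
proof -
  have "1 * D \<le> R" unfolding R_def using k_ge_128 D_ge_32 by (intro mult_right_mono) auto
  then show "L \<le> R" "32 \<le> R" using D_ge_L D_ge_32 by auto
qed

lemma n_pos: "0 < n" using n_eq exp_gt_zero[of L] by linarith

lemma R_le_n: "R \<le> real n" using R_le by (simp add: R_def)

lemma n_div_L_le: "n / L \<le> n"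
proof -
  have "real n * 1 \<le> real n * L" using L_ge by (intro mult_left_mono) auto
  then show ?thesis using L_pos by (simp add: field_simps)
qed

end

text \<open>The deterministic interface to the random part. In \<open>growth\<close> the quotient by
  \<open>2 * n\<close> accounts for overlapping edges, and \<open>2 / L\<close> is the sum of a
  \<open>1 / L\<close> for lower-order terms of the mean and a \<open>1 / L\<close> for the
  deviation below it.\<close>

locale tame_hypergraph = expansion_parameters k n D L
  for k n :: nat and D L :: real +
  fixes V :: "'a set" and E :: "'a set set"
  assumes finite_V: "finite V" and card_V: "card V = n"
    and edges: "\<And>e. e \<in> E \<Longrightarrow> e \<subseteq> V \<and> card e = k"
    and degree: "\<And>v. v \<in> V \<Longrightarrow> real (card {e \<in> E. v \<in> e}) \<le> (1 + 1 / L) * D"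
    and growth: "\<And>A. A \<subseteq> V \<Longrightarrow> A \<noteq> {} \<Longrightarrow> real (card A) * (real k * D) \<le> real n \<Longrightarrow>
      real (card A) * (real k * D) * (1 - real (card A) * (real k * D) / (2 * real n) - 2 / L)
        \<le> real (card (cover E A))"
    and spread: "\<And>B. B \<subseteq> E \<Longrightarrow> B \<noteq> {} \<Longrightarrow> card B * k \<le> n \<Longrightarrow> card B * k \<le> 10 * card (\<Union>B)"
begin

lemma Union_E: "\<Union>E \<subseteq> V" using edges by blast

lemma finite_E: "finite E"
proof (rule finite_subset)
  show "E \<subseteq> Pow V" using edges by blast
  show "finite (Pow V)" using finite_V by simp
qed

lemma finite_sub: "A \<subseteq> V \<Longrightarrow> finite A"
  by (rule finite_subset[OF _ finite_V])

lemma card_mono_real: "finite B \<Longrightarrow> A \<subseteq> B \<Longrightarrow> real (card A) \<le> real (card B)"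
  by (simp add: card_mono)

lemma card_le_n: "A \<subseteq> V \<Longrightarrow> card A \<le> n" using card_mono[OF finite_V, of A] by (simp add: card_V)

lemma cover_subset: "cover E A \<subseteq> V" using Union_E unfolding cover_def by blast

lemma finite_NV: "finite (NV V E r A)" by (rule finite_sub[OF NV_subset])

text \<open>Each edge at \<open>v\<close> contributes at most \<open>k - 1\<close> vertices besides
  \<open>v\<close>, and the saving pays for counting \<open>v\<close> itself. The growth factor
  therefore carries no additive \<open>1\<close>.\<close>

lemma card_step_le:
  assumes "S \<subseteq> V"
  shows "real (card (S \<union> cover E S)) \<le> real (card S) * ((1 + 1 / L) * R)"
proof -
  let ?N = "\<lambda>v. insert v (\<Union>e\<in>{e \<in> E. v \<in> e}. e - {v})"
  have fin: "finite S" by (rule finite_sub) fact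
  have bound: "real (card (?N v)) \<le> (1 + 1 / L) * R" if "v \<in> S" for v
  proof -
    let ?Ev = "{e \<in> E. v \<in> e}"
    have finE: "finite e" if "e \<in> ?Ev" for e using that edges finite_sub by blast
    have "card (?N v) \<le> 1 + card (\<Union>e\<in>?Ev. e - {v})"
      by (metis (no_types, lifting) card_insert_le_m1 Suc_eq_plus1_left card_insert_if le_SucI order_refl
          card.infinite finite_insert zero_le)
    also have "card (\<Union>e\<in>?Ev. e - {v}) \<le> (\<Sum>e\<in>?Ev. card (e - {v}))"
      using finite_E by (intro card_UN_le) auto
    also have "(\<Sum>e\<in>?Ev. card (e - {v})) = (\<Sum>e\<in>?Ev. k - 1)"
      using edges finE by (intro sum.cong) auto
    also have "\<dots> = card ?Ev * (k - 1)" by simp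
    finally have "real (card (?N v)) \<le> 1 + real (card ?Ev) * real (k - 1)"
      by (simp flip: of_nat_mult of_nat_Suc add: of_nat_le_iff del: of_nat_diff)
    also have "\<dots> \<le> 1 + (1 + 1 / L) * D * (real k - 1)"
      using degree[of v] that assms k_ge_128
      by (intro add_left_mono mult_mono) (auto simp: of_nat_diff)
    also have "\<dots> \<le> (1 + 1 / L) * R"
    proof -
      have "1 * 1 \<le> (1 + 1 / L) * D" using L_pos D_ge_32 by (intro mult_mono) auto
      then show ?thesis by (simp add: R_def algebra_simps)
    qed
    finally show ?thesis .
  qed
  have "S \<union> cover E S \<subseteq> (\<Union>v\<in>S. ?N v)" by (auto simp: cover_def)
  moreover have "finite (\<Union>v\<in>S. ?N v)"
    using fin finite_E edges finite_sub by (auto 0 3)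
  ultimately have "card (S \<union> cover E S) \<le> card (\<Union>v\<in>S. ?N v)" by (rule card_mono[rotated])
  also have "\<dots> \<le> (\<Sum>v\<in>S. card (?N v))" by (rule card_UN_le[OF fin])
  finally have "real (card (S \<union> cover E S)) \<le> (\<Sum>v\<in>S. real (card (?N v)))"
    by (simp flip: of_nat_sum)
  also have "\<dots> \<le> (\<Sum>v\<in>S. (1 + 1 / L) * R)" by (intro sum_mono bound)
  finally show ?thesis by simp
qed

lemma card_NV_le:
  assumes "A \<subseteq> V"
  shows "real (card (NV V E r A)) \<le> real (card A) * ((1 + 1 / L) * R) ^ r"
proof (induction r)
  case 0
  then show ?case using assms by (simp add: NV_0)
next
  case (Suc r)
  have "real (card (NV V E (Suc r) A)) \<le> real (card (NV V E r A)) * ((1 + 1 / L) * R)"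
    unfolding NV_Suc[OF Union_E assms] by (rule card_step_le[OF NV_subset])
  also have "\<dots> \<le> real (card A) * ((1 + 1 / L) * R) ^ r * ((1 + 1 / L) * R)"
    using Suc L_pos R_ge by (intro mult_right_mono) auto
  finally show ?case by (simp add: algebra_simps)
qed

text \<open>Below this size the overlap term of \<open>growth\<close> is at most
  \<open>3 / (2 * L)\<close>, so the total relative loss stays under \<open>4 / L\<close>.\<close>

lemma card_step_ge_small:
  assumes "S \<subseteq> V" "real (card S) * R \<le> 3 * (n / L)"
  shows "(1 - 4 / L) * (real (card S) * R) \<le> real (card (S \<union> cover E S))"
proof (cases "S = {}")
  case False
  define s where "s = real (card S) * R"
  have "3 * (n / L) \<le> real n" using L_ge n_pos by (simp add: field_simps)
  then have "s \<le> n" using assms by (simp add: s_def)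
  have "s / (2 * n) \<le> 3 * (n / L) / (2 * n)"
    using assms n_pos by (intro divide_right_mono) (auto simp: s_def)
  also have "\<dots> \<le> 2 / L" using n_pos L_pos by (simp add: field_simps)
  finally have "s * (1 - 4 / L) \<le> s * (1 - s / (2 * n) - 2 / L)"
    using R_ge by (intro mult_left_mono) (auto simp: s_def)
  also have "\<dots> \<le> real (card (cover E S))"
    using growth[OF assms(1) False] \<open>s \<le> n\<close> by (simp add: s_def R_def)
  also have "\<dots> \<le> real (card (S \<union> cover E S))"
    by (rule card_mono_real) (use finite_sub[OF assms(1)] finite_sub[OF cover_subset] in auto)
  finally show ?thesis by (simp add: s_def mult.commute)
qed auto

text \<open>\<open>growth\<close> reaches only up to \<open>card A * R \<le> n\<close>, where it
  retains a quarter. A larger \<open>S\<close> is replaced by a subset of about \<open>n / R\<close>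
  vertices, at the price of another factor \<open>2\<close>.\<close>

lemma card_step_ge:
  assumes "S \<subseteq> V"
  shows "min (real (card S) * R) n / 8 \<le> real (card (S \<union> cover E S))"
proof -
  have le_n: "real (card A) * R / 4 \<le> real (card (cover E A))"
    if A: "A \<subseteq> V" "A \<noteq> {}" "real (card A) * R \<le> n" for A
  proof -
    define s where "s = real (card A) * R"
    have "2 / L \<le> 1 / 4" "s / (2 * n) \<le> 1 / 2"
      using L_ge n_pos A by (auto simp: field_simps s_def)
    then have "1 / 4 \<le> 1 - s / (2 * n) - 2 / L" by linarith
    then have "s * (1 / 4) \<le> s * (1 - s / (2 * n) - 2 / L)"
      by (rule mult_left_mono) (use R_ge in \<open>simp add: s_def\<close>)
    also have "\<dots> \<le> real (card (cover E A))"
      using growth[OF A(1,2)] A(3) by (simp add: s_def R_def)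
    finally show ?thesis by (simp add: s_def)
  qed
  show ?thesis
  proof (cases "S = {}")
    case nonempty: False
    obtain A where A: "A \<subseteq> S" "A \<noteq> {}" "real (card A) * R \<le> n"
        "min (real (card S) * R) n \<le> 2 * (real (card A) * R)"
    proof (cases "real (card S) * R \<le> n")
      case True
      have "0 \<le> real (card S) * R" using R_ge by simp
      then have "min (real (card S) * R) n \<le> 2 * (real (card S) * R)" by linarith
      then show ?thesis using True nonempty by (intro that[of S]) blast+
    next
      case False
      \<comment> \<open>Rounding down loses at most a factor \<open>2\<close>, since
        \<open>1 \<le> n / R\<close>.\<close>
      define m where "m = nat \<lfloor>n / R\<rfloor>"
      have q: "1 \<le> n / R" "0 < R" using R_le_n R_ge by auto
      then have "real m = of_int \<lfloor>n / R\<rfloor>" by (simp add: m_def)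
      then have m: "real m \<le> n / R" "n / R < real m + 1" by linarith+
      then have "1 \<le> m" using q by linarith
      have "n / R < real (card S)" using False q by (simp add: field_simps)
      then have "m \<le> card S" using m by linarith
      then obtain A where "A \<subseteq> S" "card A = m" using obtain_subset_with_card_n by metis
      moreover have "n / R \<le> 2 * real m" using m \<open>1 \<le> m\<close> by linarith
      ultimately show ?thesis using m q \<open>1 \<le> m\<close> by (intro that[of A]) (auto simp: field_simps)
    qed
    have "min (real (card S) * R) n / 8 \<le> real (card A) * R / 4" using A(4) by linarith
    also have "\<dots> \<le> real (card (cover E A))" using A assms by (intro le_n) auto
    also have "\<dots> \<le> real (card (S \<union> cover E S))"
    proof (rule card_mono_real)
      show "finite (S \<union> cover E S)" using finite_sub[OF assms] finite_sub[OF cover_subset] by blast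
      show "cover E A \<subseteq> S \<union> cover E S" using A(1) by (auto simp: cover_def)
    qed
    finally show ?thesis .
  qed auto
qed

section \<open>Iterating the growth step\<close>

lemma card_NV_Suc_ge:
  assumes "A \<subseteq> V"
  shows "min (real (card (NV V E r A)) * R) n / 8 \<le> real (card (NV V E (Suc r) A))"
  unfolding NV_Suc[OF Union_E assms] by (rule card_step_ge[OF NV_subset])

text \<open>Since \<open>exp 1 \<le> 3\<close>. This caps the number of steps by \<open>L\<close>,
  over which relative errors of order \<open>1 / L\<close> accumulate only to a constant.\<close>

lemma exponent_le_L:
  assumes "x ^ r \<le> real n" "3 \<le> x"
  shows "real r \<le> L"
proof -
  have "exp (real r) = exp 1 ^ r" by (simp flip: exp_of_nat_mult)
  also have "\<dots> \<le> x ^ r" using assms exp_le by (intro power_mono) auto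
  finally have "exp (real r) \<le> exp L" using assms n_eq by simp
  then show ?thesis by simp
qed

lemma upper_power_le:
  assumes "real r \<le> L"
  shows "(1 + 1 / L) ^ r \<le> 3"
proof -
  have "(1 + 1 / L) ^ r \<le> exp (1 / L) ^ r" using L_pos by (intro power_mono exp_ge_add_one_self) auto
  also have "\<dots> = exp (r / L)" by (simp flip: exp_of_nat_mult)
  also have "\<dots> \<le> exp 1" using assms L_pos by simp
  finally show ?thesis using exp_le by linarith
qed

lemma lower_power_ge:
  assumes "real r \<le> L"
  shows "exp (-8) \<le> (1 - 4 / L) ^ r"
proof -
  have "exp (-8) \<le> exp (real r * (- 2 * (4 / L)))" using assms L_pos by (simp add: field_simps)
  also have "\<dots> = exp (- 2 * (4 / L)) ^ r" by (rule exp_of_nat_mult)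
  also have "\<dots> \<le> (1 - 4 / L) ^ r"
    using L_ge by (intro power_mono exp_minus_two_le) (auto simp: field_simps)
  finally show ?thesis .
qed

lemma card_NV_ge_small:
  assumes "A \<subseteq> V" "A \<noteq> {}" "real (card A) * R ^ r \<le> n / L"
  shows "(1 - 4 / L) ^ r * (real (card A) * R ^ r) \<le> real (card (NV V E r A))"
  using assms(3)
proof (induction r)
  case 0
  then show ?case using assms by (simp add: NV_0)
next
  case (Suc r)
  let ?a = "real (card A)"
  have a: "1 \<le> ?a" using assms finite_sub by (simp add: Suc_le_eq card_gt_0_iff)
  have R1: "1 \<le> R" using R_ge by simp
  have le: "?a * R ^ r \<le> ?a * R ^ Suc r"
    using R1 a by (intro mult_left_mono power_increasing) auto
  have "1 * R ^ r \<le> ?a * R ^ r" using a R1 by (intro mult_right_mono) auto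
  then have "R ^ r \<le> n" using le Suc.prems n_div_L_le by linarith
  then have r: "real r \<le> L" using R_ge by (intro exponent_le_L) auto
  \<comment> \<open>The neighbourhood must not be too large either: only below size \<open>3n / (L R)\<close> does the next step
    lose no more than the factor \<open>1 - 4 / L\<close>.\<close>
  have "real (card (NV V E r A)) * R \<le> ?a * ((1 + 1 / L) * R) ^ r * R"
    using R1 by (intro mult_right_mono card_NV_le assms) auto
  also have "\<dots> = (1 + 1 / L) ^ r * (?a * R ^ Suc r)" by (simp add: power_mult_distrib)
  also have "\<dots> \<le> 3 * (n / L)"
    using Suc.prems upper_power_le[OF r] R1 by (intro mult_mono) auto
  finally have small: "real (card (NV V E r A)) * R \<le> 3 * (n / L)" .
  have L1: "0 \<le> 1 - 4 / L" using L_ge by simp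
  have "(1 - 4 / L) ^ Suc r * (?a * R ^ Suc r) = (1 - 4 / L) * ((1 - 4 / L) ^ r * (?a * R ^ r) * R)"
    by (simp only: power_Suc mult_ac)
  also have "\<dots> \<le> (1 - 4 / L) * (real (card (NV V E r A)) * R)"
    using Suc.IH le Suc.prems R1 L1 by (intro mult_left_mono mult_right_mono) auto
  also have "\<dots> \<le> real (card (NV V E (Suc r) A))"
    unfolding NV_Suc[OF Union_E assms(1)] by (rule card_step_ge_small[OF NV_subset small])
  finally show ?case .
qed

text \<open>Up to radius \<open>r\<close> the losses multiply to at least \<open>exp (-8)\<close>;
  the step that may leave the range below \<open>n / L\<close> costs the factor \<open>8\<close> of
  \<open>card_step_ge\<close>.\<close>

lemma card_NV_ge_next:
  assumes "A \<subseteq> V" "A \<noteq> {}" "real (card A) * R ^ r \<le> n / L"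
  shows "exp (-8) / 8 * min (real (card A) * R ^ Suc r) n \<le> real (card (NV V E (Suc r) A))"
    and "real r \<le> L"
proof -
  let ?a = "real (card A)"
  have a: "1 \<le> ?a" using assms finite_sub by (simp add: Suc_le_eq card_gt_0_iff)
  have R1: "1 \<le> R" using R_ge by simp
  have "1 * R ^ r \<le> ?a * R ^ r" using a R1 by (intro mult_right_mono) auto
  then have "R ^ r \<le> n" using assms(3) n_div_L_le by linarith
  then show r: "real r \<le> L" using R_ge by (intro exponent_le_L) auto
  have "exp (-8) * (?a * R ^ r) \<le> (1 - 4 / L) ^ r * (?a * R ^ r)"
    using R1 by (intro mult_right_mono lower_power_ge r) auto
  also have "\<dots> \<le> real (card (NV V E r A))" by (rule card_NV_ge_small) fact+
  finally have "exp (-8) * (?a * R ^ r) * R \<le> real (card (NV V E r A)) * R"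
    using R1 by (intro mult_right_mono) auto
  moreover have "exp (-8) * real n \<le> 1 * real n" by (intro mult_right_mono) auto
  ultimately have "min (exp (-8) * (?a * R ^ Suc r)) (exp (-8) * n) / 8 \<le> min (real (card (NV V E r A)) * R) n / 8"
    by (intro divide_right_mono min.mono) (simp_all add: mult_ac)
  also have "\<dots> \<le> real (card (NV V E (Suc r) A))" by (rule card_NV_Suc_ge) fact
  also have "min (exp (-8) * (?a * R ^ Suc r)) (exp (-8) * n) = exp (-8) * min (?a * R ^ Suc r) (real n)"
    by (simp add: min_mult_distrib_left)
  finally show "exp (-8) / 8 * min (?a * R ^ Suc r) n \<le> real (card (NV V E (Suc r) A))" by simp
qed

text \<open>The upper growth factor appears in this lower bound because it dominates the average
  degree, so the version with the average degree follows by monotonicity.\<close>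

lemma card_NV_ge:
  assumes "A \<subseteq> V" "1 \<le> r"
  shows "exp (-8) / 64 * min (real (card A) * ((1 + 1 / L) * R) ^ r) n \<le> real (card (NV V E r A))"
proof (cases "A = {}")
  case False
  let ?a = "real (card A)"
  have a: "1 \<le> ?a" using assms False finite_sub by (simp add: Suc_le_eq card_gt_0_iff)
  have R1: "1 \<le> R" using R_ge by simp
  obtain r' where r': "r = Suc r'" using assms(2) by (cases r) auto
  show ?thesis
  proof (cases "?a * R ^ r' \<le> n / L")
    case True
    note * = card_NV_ge_next[OF assms(1) False True]
    have "(1 + 1 / L) ^ r = (1 + 1 / L) ^ r' * (1 + 1 / L)" by (simp add: r')
    also have "\<dots> \<le> 3 * 2" using upper_power_le[OF *(2)] L_ge by (intro mult_mono) auto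
    finally have "(1 + 1 / L) ^ r * (?a * R ^ r) \<le> 8 * (?a * R ^ r)"
      using R1 by (intro mult_right_mono) auto
    then have "min (?a * ((1 + 1 / L) * R) ^ r) n \<le> 8 * min (?a * R ^ r) n"
      by (auto simp: power_mult_distrib min_def mult_ac)
    then have "exp (-8) / 64 * min (?a * ((1 + 1 / L) * R) ^ r) n \<le> exp (-8) / 64 * (8 * min (?a * R ^ r) n)"
      by (intro mult_left_mono) auto
    also have "\<dots> \<le> real (card (NV V E r A))" using *(1) by (simp add: r')
    finally show ?thesis .
  next
    case big: False
    \<comment> \<open>The first radius at which the predicted size exceeds \<open>n / L\<close>. It
      is smaller than \<open>r\<close>, which leaves room for one more step.\<close>
    define j where "j = (LEAST j. n / L < ?a * R ^ j)"
    have j: "n / L < ?a * R ^ j" unfolding j_def by (rule LeastI[of "\<lambda>j. n / L < ?a * R ^ j" r']) (use big in linarith)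
    have jr: "j \<le> r'" unfolding j_def by (rule Least_le) (use big in linarith)
    have e8: "exp (-8) \<le> (1::real)" "exp (-8) \<le> (8::real)"
      using exp_le_one_iff[of "-8::real"] by linarith+
    have "exp (-8) / 8 * (n / L) \<le> real (card (NV V E j A))"
    proof (cases j)
      case 0
      then have "n / L \<le> real (card (NV V E j A))" using j assms by (simp add: NV_0)
      moreover have "exp (-8) / 8 * (n / L) \<le> 1 * (n / L)"
        by (rule mult_right_mono) (use L_pos e8 in auto)
      ultimately show ?thesis by simp
    next
      case (Suc i)
      then have i: "?a * R ^ i \<le> n / L" using not_less_Least[of i "\<lambda>j. n / L < ?a * R ^ j"] unfolding j_def by linarith
      have "exp (-8) / 8 * (n / L) \<le> exp (-8) / 8 * min (?a * R ^ j) n"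
        using j n_div_L_le by (intro mult_left_mono) auto
      also have "\<dots> \<le> real (card (NV V E j A))"
        using card_NV_ge_next(1)[OF assms(1) False i] Suc by simp
      finally show ?thesis .
    qed
    \<comment> \<open>By \<open>L \<le> R\<close>, one further step turns order \<open>n / L\<close>
      into order \<open>n\<close>.\<close>
    then have "exp (-8) / 8 * (n / L) * L \<le> real (card (NV V E j A)) * R"
      using R_ge L_pos by (intro mult_mono) auto
    then have "exp (-8) / 8 * n \<le> real (card (NV V E j A)) * R" using L_pos by simp
    moreover have "exp (-8) / 8 * n \<le> 1 * real n" by (rule mult_right_mono) (use e8 in auto)
    ultimately have "exp (-8) / 8 * n / 8 \<le> min (real (card (NV V E j A)) * R) n / 8" by linarith
    also have "\<dots> \<le> real (card (NV V E (Suc j) A))" by (rule card_NV_Suc_ge) fact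
    also have "\<dots> \<le> real (card (NV V E r A))"
      using jr r' by (intro card_mono_real finite_NV NV_mono Union_E assms(1)) auto
    finally have "exp (-8) / 64 * n \<le> real (card (NV V E r A))" by simp
    moreover have "exp (-8) / 64 * min (?a * ((1 + 1 / L) * R) ^ r) n \<le> exp (-8) / 64 * n"
      by (rule mult_left_mono) simp_all
    ultimately show ?thesis by linarith
  qed
qed simp

section \<open>Comparison of the average degree with \<open>R\<close>, and the expansion
  property\<close>

abbreviation d :: real where "d \<equiv> avg_degree V E"

text \<open>When \<open>R\<close> is of order \<open>n\<close>, overlaps within a single step may
  cost a constant factor, so the sharp lower bound carries a condition on \<open>R\<close>.\<close>

lemma d_bounds:
  shows "d \<le> (1 + 1 / L) * R" "R / 4 \<le> d" "R \<le> 3 * (n / L) \<Longrightarrow> (1 - 4 / L) * R \<le> d"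
proof -
  have d_eq: "d = (\<Sum>v\<in>V. real (card (NV V E 1 {v}))) / n" by (simp add: avg_degree_def card_V)
  have ge: "c \<le> d" if "\<And>v. v \<in> V \<Longrightarrow> c \<le> real (card (NV V E 1 {v}))" for c
  proof -
    have "(\<Sum>v\<in>V. c) \<le> (\<Sum>v\<in>V. real (card (NV V E 1 {v})))" by (intro sum_mono that)
    then show ?thesis using n_pos card_V by (simp add: d_eq field_simps)
  qed
  have step: "NV V E 1 {v} = {v} \<union> cover E {v}" if "v \<in> V" for v
    using NV_Suc[OF Union_E, of "{v}" 0] that by (simp add: NV_0)
  have "(\<Sum>v\<in>V. real (card (NV V E 1 {v}))) \<le> (\<Sum>v\<in>V. (1 + 1 / L) * R)"
    using card_step_le[of "{v}" for v] step by (intro sum_mono) force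
  then show "d \<le> (1 + 1 / L) * R" using n_pos card_V by (simp add: d_eq field_simps)
  show "(1 - 4 / L) * R \<le> d" if "R \<le> 3 * (n / L)"
  proof (rule ge)
    fix v assume "v \<in> V"
    then show "(1 - 4 / L) * R \<le> real (card (NV V E 1 {v}))"
      using card_step_ge_small[of "{v}"] that step by simp
  qed
  show "R / 4 \<le> d"
  proof (rule ge)
    fix v assume v: "v \<in> V"
    have "2 / L \<le> 1 / 4" "R / (2 * n) \<le> 1 / 2"
      using L_ge n_pos R_le_n by (auto simp: field_simps)
    then have "1 / 4 \<le> 1 - R / (2 * n) - 2 / L" by linarith
    then have "R * (1 / 4) \<le> R * (1 - R / (2 * n) - 2 / L)"
      by (rule mult_left_mono) (use R_ge in simp)
    also have "\<dots> \<le> real (card (cover E {v}))"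
      using growth[of "{v}"] v R_le_n by (simp add: R_def)
    also have "\<dots> \<le> real (card (NV V E 1 {v}))"
      unfolding step[OF v] by (rule card_mono_real) (auto intro: finite_sub[OF cover_subset])
    finally show "R / 4 \<le> real (card (NV V E 1 {v}))" by simp
  qed
qed

text \<open>For \<open>r = 1\<close> the crude \<open>R / 4 \<le> d\<close> suffices. For larger
  \<open>r\<close>, \<open>d ^ 2 \<le> n\<close> makes \<open>R\<close> small enough for the sharp
  lower bound on \<open>d\<close>, whose \<open>r\<close>-th power loses only a constant since
  \<open>r \<le> L\<close>.\<close>

lemma power_le_d_power:
  assumes "d ^ r \<le> n" "1 \<le> r"
  shows "((1 + 1 / L) * R) ^ r \<le> 3 * exp 8 * d ^ r"
proof -
  have d8: "8 \<le> d" using d_bounds(2) R_ge by simp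
  have e8: "9 \<le> exp (8::real)" using exp_ge_add_one_self[of "8::real"] by simp
  show ?thesis
  proof (cases "r = 1")
    case True
    have "(1 + 1 / L) * R \<le> 2 * (4 * d)"
      using L_ge R_ge d_bounds(2) by (intro mult_mono) auto
    also have "\<dots> \<le> 3 * exp 8 * d" using d8 e8 by simp
    finally show ?thesis using True by simp
  next
    case False
    have r: "real r \<le> L" using assms d8 by (intro exponent_le_L) auto
    have "d\<^sup>2 \<le> d ^ r" using d8 assms False by (intro power_increasing) auto
    then have "d\<^sup>2 \<le> exp (L / 2) ^ 2" using assms n_eq by (simp flip: exp_of_nat_mult)
    then have d_le: "d \<le> exp (L / 2)" by (rule power2_le_imp_le) simp
    \<comment> \<open>The aim is \<open>4 * L \<le> 3 * sqrt n\<close>, with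
      \<open>exp (L / 2)\<close> in the role of \<open>sqrt n\<close>; \<open>L * (L / 8)\<close> is
      the quadratic term of its Taylor bound.\<close>
    have "L * (4 / 3) \<le> L * (L / 8)" using L_ge by (intro mult_left_mono) auto
    also have "\<dots> \<le> exp (L / 2)"
      using exp_lower_Taylor_quadratic[of "L / 2"] L_ge by (simp add: power2_eq_square)
    finally have "4 * L \<le> 3 * exp (L / 2)" by simp
    then have "4 * L * d \<le> 3 * exp (L / 2) * exp (L / 2)"
      by (rule mult_mono[OF _ d_le]) (use d8 in auto)
    also have "\<dots> = 3 * n" by (simp add: n_eq mult.assoc flip: exp_add)
    finally have "4 * d \<le> 3 * (n / L)" using L_pos by (simp add: field_simps)
    then have dR: "(1 - 4 / L) * R \<le> d" using d_bounds(2) by (intro d_bounds(3)) simp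
    have "exp (-8) * R ^ r \<le> (1 - 4 / L) ^ r * R ^ r"
      using R_ge by (intro mult_right_mono lower_power_ge r) auto
    also have "\<dots> = ((1 - 4 / L) * R) ^ r" by (simp add: power_mult_distrib)
    also have "\<dots> \<le> d ^ r" using dR L_ge R_ge by (intro power_mono) auto
    finally have "R ^ r \<le> exp 8 * d ^ r" by (simp add: exp_minus field_simps)
    then have "(1 + 1 / L) ^ r * R ^ r \<le> 3 * (exp 8 * d ^ r)"
      using upper_power_le[OF r] R_ge by (intro mult_mono) auto
    then show ?thesis by (simp add: power_mult_distrib)
  qed
qed

text \<open>As in \<open>card_step_ge\<close>, a family too large for \<open>spread\<close> is cut
  down, here to \<open>n div k\<close> edges. The factor \<open>20\<close> is \<open>10\<close> from
  \<open>spread\<close> times \<open>2\<close> from rounding.\<close>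

lemma card_Union_ge:
  assumes "B \<subseteq> E"
  shows "min (real (card B) * real k) n / 20 \<le> real (card (\<Union>B))"
proof (cases "B = {}")
  case nonempty: False
  have finB: "finite B" using assms finite_E finite_subset by blast
  have kn: "k \<le> n"
  proof -
    have "real k * 1 \<le> real k * D" using D_ge_32 by (intro mult_left_mono) auto
    then show ?thesis using R_le by simp
  qed
  obtain C where C: "C \<subseteq> B" "C \<noteq> {}" "card C * k \<le> n" "min (card B * k) n \<le> 2 * (card C * k)"
  proof (cases "card B * k \<le> n")
    case True
    then show ?thesis using nonempty by (intro that[of B]) auto
  next
    case False
    define m where "m = n div k"
    have m: "1 \<le> m" "m * k \<le> n" "n < m * k + k"
      using kn k_ge_128 mod_less_divisor[of k n] div_mult_mod_eq[of n k]
      unfolding m_def by (simp add: div_greater_zero_iff Suc_le_eq, simp, linarith)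
    have "m * k < card B * k" using False m(2) by linarith
    then have "m \<le> card B" by simp
    then obtain C where C: "C \<subseteq> B" "card C = m" using obtain_subset_with_card_n by metis
    have "k \<le> m * k" using m(1) by simp
    then have "n \<le> 2 * (m * k)" using m(3) by linarith
    then show ?thesis using m C by (intro that[of C]) auto
  qed
  have "card C * k \<le> 10 * card (\<Union>C)" using C assms by (intro spread) auto
  moreover have "card (\<Union>C) \<le> card (\<Union>B)"
    using C(1) assms Union_E by (intro card_mono Union_mono finite_sub) blast+
  ultimately have "min (card B * k) n \<le> 20 * card (\<Union>B)" using C(4) by linarith
  then have "real (min (card B * k) n) \<le> 20 * real (card (\<Union>B))" by linarith
  then show ?thesis unfolding of_nat_min of_nat_mult by linarith
qed simp

lemma min_mult_ge:
  fixes c x y :: real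
  assumes "0 \<le> c" "c \<le> 1" "0 \<le> y"
  shows "c * min x y \<le> min (c * x) y"
proof -
  have "c * y \<le> 1 * y" using assms by (intro mult_right_mono) auto
  moreover have "c * min x y \<le> c * x" "c * min x y \<le> c * y" using assms by (auto intro: mult_left_mono)
  ultimately show ?thesis by simp
qed

text \<open>(A.3) determines the constant: \<open>1280\<close> is \<open>64\<close> from
  \<open>card_NV_ge\<close> times \<open>20\<close> from \<open>card_Union_ge\<close>. Its inverse
  \<open>1280 * exp 8\<close> also covers the factor \<open>3 * exp 8\<close> of the upper
  bounds.\<close>

lemma is_expanding: "expanding (exp (-8) / 1280) k V E"
proof -
  define \<xi> :: real where "\<xi> = exp (-8) / 1280"
  have d8: "8 \<le> d" using d_bounds(2) R_ge by simp
  have inv: "1 / \<xi> = 1280 * exp 8" by (simp add: \<xi>_def exp_minus field_simps)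
  have lower: "exp (-8) / 64 * min (real (card A) * d ^ r) n \<le> real (card (NV V E r A))"
    if "A \<subseteq> V" "1 \<le> r" for A r
  proof -
    have "real (card A) * d ^ r \<le> real (card A) * ((1 + 1 / L) * R) ^ r"
      using d_bounds(1) d8 by (intro mult_left_mono power_mono) auto
    then have "exp (-8) / 64 * min (real (card A) * d ^ r) n
        \<le> exp (-8) / 64 * min (real (card A) * ((1 + 1 / L) * R) ^ r) n"
      by (intro mult_left_mono) auto
    also have "\<dots> \<le> real (card (NV V E r A))" by (rule card_NV_ge) fact+
    finally show ?thesis .
  qed
  have A1: "real (card (NE E r {v})) \<le> 1 / \<xi> * (d ^ r / real k)"
    if v: "v \<in> V" "1 \<le> r" "d ^ r \<le> sqrt (n * real k)" for v r
  proof -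
    obtain r' where r': "r = Suc r'" using v by (cases r) auto
    have "D * real k \<ge> 1 * real k" using D_ge_32 by (intro mult_right_mono) auto
    then have "real k \<le> n" using R_le by (simp add: mult.commute)
    then have "sqrt (n * real k) \<le> sqrt (n * real n)" by (intro real_sqrt_le_mono mult_left_mono) auto
    then have "d ^ r \<le> n" using v by simp
    then have pw: "((1 + 1 / L) * R) ^ r \<le> 3 * exp 8 * d ^ r" using v by (intro power_le_d_power) auto
    have "NE E r {v} \<subseteq> (\<Union>u\<in>NV V E r' {v}. {e \<in> E. u \<in> e})"
      unfolding r' NE_Suc_singleton[OF Union_E] by auto
    then have "card (NE E r {v}) \<le> card (\<Union>u\<in>NV V E r' {v}. {e \<in> E. u \<in> e})"
      using finite_E finite_NV by (intro card_mono) auto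
    also have "\<dots> \<le> (\<Sum>u\<in>NV V E r' {v}. card {e \<in> E. u \<in> e})" by (rule card_UN_le[OF finite_NV])
    finally have "real (card (NE E r {v})) \<le> (\<Sum>u\<in>NV V E r' {v}. real (card {e \<in> E. u \<in> e}))"
      by (simp flip: of_nat_sum)
    also have "\<dots> \<le> (\<Sum>u\<in>NV V E r' {v}. (1 + 1 / L) * D)"
      using NV_subset[of V E r' "{v}"] by (intro sum_mono degree) blast
    also have "\<dots> = real (card (NV V E r' {v})) * ((1 + 1 / L) * D)" by simp
    also have "\<dots> \<le> (real (card {v}) * ((1 + 1 / L) * R) ^ r') * ((1 + 1 / L) * D)"
      using v L_pos D_ge_32 by (intro mult_right_mono card_NV_le) auto
    \<comment> \<open>As \<open>R = k * D\<close>, the edges at a vertex complete the power and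
      leave the \<open>1 / k\<close> of (A.1).\<close>
    also have "\<dots> = ((1 + 1 / L) * R) ^ r / real k" using k_ge_128 by (simp add: r' R_def)
    also have "\<dots> \<le> 3 * exp 8 * d ^ r / real k" using pw by (intro divide_right_mono) auto
    also have "\<dots> \<le> 1280 * exp 8 * d ^ r / real k"
      using d8 by (intro divide_right_mono mult_right_mono) auto
    finally show ?thesis by (simp add: inv)
  qed
  have A2: "real (card (NV V E r A)) \<le> 1 / \<xi> * real (card A) * d ^ r" if A: "A \<subseteq> V" "1 \<le> r" for A r
  \<comment> \<open>If \<open>d ^ r\<close> exceeds \<open>n\<close> and \<open>A\<close> is
    nonempty, the right-hand side is larger than the number of vertices.\<close>
  proof (cases "A = {} \<or> d ^ r \<le> n")
    case True
    then show ?thesis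
    proof
      assume "d ^ r \<le> n"
      have "real (card (NV V E r A)) \<le> real (card A) * ((1 + 1 / L) * R) ^ r" by (rule card_NV_le) fact
      also have "\<dots> \<le> real (card A) * (3 * exp 8 * d ^ r)"
        using \<open>d ^ r \<le> n\<close> A by (intro mult_left_mono power_le_d_power) auto
      also have "\<dots> \<le> real (card A) * (1280 * exp 8 * d ^ r)"
        using d8 by (intro mult_left_mono mult_right_mono) auto
      finally show ?thesis by (simp add: inv mult_ac)
    qed (simp add: NV_empty)
  next
    case False
    then have a: "1 \<le> real (card A)" using A finite_sub by (simp add: Suc_le_eq card_gt_0_iff)
    have "1 \<le> exp (8::real)" by simp
    then have "1 * 1 \<le> 1280 * exp 8 * real (card A)"
      by (intro mult_mono[OF _ a]) linarith+
    then have "1 * 1 * real n \<le> 1280 * exp 8 * real (card A) * d ^ r"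
      by (rule mult_mono) (use False in auto)
    then show ?thesis using card_le_n[OF NV_subset, of E r A] by (simp add: inv)
  qed
  have A2': "\<xi> * min (real (card A) * d ^ r) n \<le> real (card (NV V E r A))" if A: "A \<subseteq> V" "1 \<le> r" for A r
  proof -
    have "\<xi> * min (real (card A) * d ^ r) n \<le> exp (-8) / 64 * min (real (card A) * d ^ r) n"
      unfolding \<xi>_def by (rule mult_right_mono) (use d8 in simp_all)
    then show ?thesis using lower[OF A] by linarith
  qed
  have A3: "\<xi> * min (real (card B) * real k * d ^ r) n \<le> real (card (NV V E r (\<Union>B)))"
    if B: "B \<subseteq> E" "1 \<le> r" for B r
  proof -
    let ?b = "real (card B) * real k"
    have UB: "\<Union>B \<subseteq> V" using B Union_E by blast
    have dr: "1 \<le> d ^ r" using d8 by (intro one_le_power) auto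
    \<comment> \<open>Truncating \<open>card B * k\<close> at \<open>n\<close> beforehand is
      harmless because \<open>1 \<le> d ^ r\<close>; afterwards \<open>card_Union_ge\<close> applies
      and \<open>lower\<close> can be used for the union of \<open>B\<close>.\<close>
    have "min (?b * d ^ r) n \<le> min (?b * d ^ r) (n * d ^ r)"
      using mult_left_mono[OF dr, of "real n"] by (intro min.mono order_refl) auto
    also have "\<dots> = min ?b n * d ^ r" using dr by (simp add: min_mult_distrib_right)
    finally have "min (?b * d ^ r) n \<le> min (min ?b n * d ^ r) n" by simp
    then have "(1 / 20) * min (?b * d ^ r) n \<le> (1 / 20) * min (min ?b n * d ^ r) n" by simp
    also have "\<dots> \<le> min ((1 / 20) * (min ?b n * d ^ r)) n" by (rule min_mult_ge) auto
    also have "\<dots> \<le> min (real (card (\<Union>B)) * d ^ r) n"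
    proof (rule min.mono[OF _ order_refl])
      have "min ?b n / 20 * d ^ r \<le> real (card (\<Union>B)) * d ^ r"
        using dr by (intro mult_right_mono card_Union_ge B) auto
      then show "1 / 20 * (min ?b n * d ^ r) \<le> real (card (\<Union>B)) * d ^ r" by simp
    qed
    finally have "exp (-8) / 64 * ((1 / 20) * min (?b * d ^ r) n)
        \<le> exp (-8) / 64 * min (real (card (\<Union>B)) * d ^ r) n"
      by (rule mult_left_mono) simp
    also have "\<dots> \<le> real (card (NV V E r (\<Union>B)))" by (rule lower[OF UB B(2)])
    finally show ?thesis by (simp add: \<xi>_def)
  qed
  have "real k * 32 \<le> real k * D" using D_ge_32 by (intro mult_left_mono) auto
  then have "real k \<le> d" using d_bounds(2) by (simp add: R_def)
  moreover have "0 < \<xi>" "\<xi> \<le> 1"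
    using exp_le_one_iff[of "-8::real"] exp_gt_zero[of "-8::real"] unfolding \<xi>_def by linarith+
  moreover have "k_graph k V E" unfolding k_graph_def using finite_V edges by blast
  ultimately show ?thesis
    unfolding expanding_def Let_def card_V \<xi>_def[symmetric]
    by - (intro conjI allI impI ballI; (assumption | (rule A1 A2 A2' A3; assumption)))
qed

end

section \<open>Random hypergraphs\<close>

lemma sum_of_bool_fun_upd:
  assumes "finite T"
  shows "(\<Sum>e'\<in>T. of_bool ((g(e := True)) e') :: real) - (\<Sum>e'\<in>T. of_bool ((g(e := False)) e')) = of_bool (e \<in> T)"
proof -
  have "(\<Sum>e'\<in>T. of_bool ((g(e := True)) e') :: real) - (\<Sum>e'\<in>T. of_bool ((g(e := False)) e'))
      = (\<Sum>e'\<in>T. if e' = e then 1 else 0)"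
    unfolding sum_subtractf[symmetric] by (intro sum.cong) auto
  then show ?thesis using assms by simp
qed

lemma expectation_card_filter:
  fixes M :: "'b pmf"
  assumes "finite T"
  shows "measure_pmf.expectation M (\<lambda>g. real (card {x \<in> T. Q g x})) = (\<Sum>x\<in>T. measure_pmf.prob M {g. Q g x})"
proof -
  have "real (card {x \<in> T. Q g x}) = (\<Sum>x\<in>T. indicator {g. Q g x} g)" for g
  proof -
    have "(\<Sum>x\<in>T. indicator {g. Q g x} g :: real) = (\<Sum>x\<in>{x \<in> T. Q g x}. 1)"
      using assms by (intro sum.mono_neutral_cong_right) (auto simp: indicator_def)
    then show ?thesis by simp
  qed
  then have "measure_pmf.expectation M (\<lambda>g. real (card {x \<in> T. Q g x}))
      = measure_pmf.expectation M (\<lambda>g. \<Sum>x\<in>T. indicator {g. Q g x} g)"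
    by (simp only:)
  also have "\<dots> = (\<Sum>x\<in>T. measure_pmf.expectation M (indicator {g. Q g x}))"
    by (intro Bochner_Integration.integral_sum measure_pmf.integrable_const_bound[where B = 1])
      (auto simp: indicator_def)
  finally show ?thesis by simp
qed

section \<open>The random hypergraph for fixed parameters\<close>

locale random_k_graph = expansion_parameters k n D L
  for k n :: nat and D L :: real +
  fixes V :: "'a set" and p :: real
  assumes finite_V: "finite V" and card_V: "card V = n"
    and D_eq: "D = p * real ((n - 1) choose (k - 1))" and p_nonneg: "0 \<le> p" and p_le_1: "p \<le> 1"
begin

definition K :: "'a set set" where "K = {e. e \<subseteq> V \<and> card e = k}"

definition G :: "('a set \<Rightarrow> bool) \<Rightarrow> 'a set set" where "G g = {e \<in> K. g e}"

abbreviation M :: "('a set \<Rightarrow> bool) pmf" where "M \<equiv> bernoullis K p"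

lemma finite_K: "finite K"
  unfolding K_def by (rule finite_subset[of _ "Pow V"]) (use finite_V in auto)

lemma k_le_n: "k \<le> n" and n_ge: "4096 \<le> real n"
proof -
  have "real k * 32 \<le> real k * D" using D_ge_32 by (intro mult_left_mono) auto
  then have "real k * 32 \<le> n" using R_le by simp
  then show "k \<le> n" "4096 \<le> real n" using k_ge_128 by linarith+
qed

lemma card_K_containing:
  assumes "v \<in> V"
  shows "card {e \<in> K. v \<in> e} = (n - 1) choose (k - 1)"
proof -
  have "insert v (V - {v}) = V" using assms by auto
  moreover have "{e. (e \<subseteq> V \<and> card e = k) \<and> v \<in> e} = {e. e \<subseteq> V \<and> card e = k \<and> v \<in> e}" by auto
  ultimately show ?thesis
    using card_subsets_containing[of "V - {v}" v k] assms finite_V card_V k_ge_128 by (simp add: K_def)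
qed

lemma card_K_meeting_le:
  assumes "A \<subseteq> V"
  shows "card {e \<in> K. e \<inter> A \<noteq> {}} \<le> card A * ((n - 1) choose (k - 1))"
proof -
  have fin: "finite A" using assms finite_V by (rule finite_subset)
  have "card {e \<in> K. e \<inter> A \<noteq> {}} \<le> card (\<Union>v\<in>A. {e \<in> K. v \<in> e})"
    using finite_K fin by (intro card_mono) auto
  also have "\<dots> \<le> (\<Sum>v\<in>A. card {e \<in> K. v \<in> e})" by (rule card_UN_le[OF fin])
  also have "\<dots> = (\<Sum>v\<in>A. (n - 1) choose (k - 1))" using assms by (intro sum.cong card_K_containing) auto
  finally show ?thesis by simp
qed

text \<open>The right-hand side is the tail exponent at relative deviation \<open>1 / L\<close>: for
  a degree, and per vertex of \<open>A\<close> for a cover. The value \<open>3 * L\<close> survives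
  the at most \<open>exp (L * a)\<close> choices of an \<open>a\<close>-set.\<close>

lemma deviation_exponent: "3 * L \<le> D / (4 * L\<^sup>2)"
proof -
  have "3 * L * (4 * L\<^sup>2) \<le> D" using D_ge by (simp add: power3_eq_cube power2_eq_square)
  then show ?thesis using L_pos by (simp add: pos_le_divide_eq)
qed

text \<open>Each potential edge at \<open>v\<close> changes the degree by \<open>1\<close>, so the
  variance proxy equals the mean \<open>D\<close>; the deviation is \<open>D / L\<close>.\<close>

lemma prob_large_degree:
  assumes "v \<in> V"
  shows "measure_pmf.prob M {g. (1 + 1 / L) * D < real (card {e \<in> G g. v \<in> e})} \<le> exp (- 3 * L)"
proof -
  define T where "T = {e \<in> K. v \<in> e}"
  have T: "finite T" "T \<subseteq> K" using finite_K by (auto simp: T_def)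
  define F where "F g = (\<Sum>e\<in>T. of_bool (g e) :: real)" for g :: "'a set \<Rightarrow> bool"
  have F: "real (card {e \<in> G g. v \<in> e}) = F g" for g
  proof -
    have "{e \<in> G g. v \<in> e} = {e \<in> T. g e}" by (auto simp: G_def T_def)
    moreover have "F g = (\<Sum>e\<in>{e \<in> T. g e}. 1)"
      unfolding F_def using T by (intro sum.mono_neutral_cong_right) auto
    ultimately show ?thesis by simp
  qed
  have EF: "measure_pmf.expectation M F = D"
  proof -
    have "{e \<in> G g. v \<in> e} = {e \<in> T. g e}" for g by (auto simp: G_def T_def)
    then have "F = (\<lambda>g. real (card {e \<in> T. g e}))" using F by auto
    then have "measure_pmf.expectation M F = (\<Sum>e\<in>T. measure_pmf.prob M {g. g e})"
      using expectation_card_filter[OF T(1), of M "\<lambda>g e. g e"] by (simp only:)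
    also have "\<dots> = (\<Sum>e\<in>T. p)"
    proof (rule sum.cong[OF refl])
      fix e assume "e \<in> T"
      then show "measure_pmf.prob M {g. g e} = p"
        using prob_bernoullis_all(1)[OF finite_K, of "{e}" p] T p_nonneg p_le_1 by auto
    qed
    also have "\<dots> = D" using card_K_containing[OF assms] by (simp add: T_def D_eq)
    finally show ?thesis .
  qed
  have "measure_pmf.prob M {g. measure_pmf.expectation M F + D / L \<le> F g} \<le> exp (- (D / L)\<^sup>2 / (4 * D))"
  proof (rule bernoullis_upper_tail[where c = "\<lambda>e. of_bool (e \<in> T)"])
    show "0 \<le> F (g(e := True)) - F (g(e := False))" for e g
      unfolding F_def sum_of_bool_fun_upd[OF T(1)] by simp
    show "F (g(e := True)) - F (g(e := False)) \<le> of_bool (e \<in> T)" for e g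
      unfolding F_def sum_of_bool_fun_upd[OF T(1)] by simp
    show "D / L * of_bool (e \<in> T) \<le> 2 * D" for e
    proof -
      have "D * 1 \<le> D * (2 * L)" using L_ge D_ge_32 by (intro mult_left_mono) auto
      then have "D / L \<le> 2 * D" using L_pos by (simp add: field_simps)
      then show ?thesis using D_ge_32 by simp
    qed
    have "(\<Sum>e\<in>K. (of_bool (e \<in> T))\<^sup>2 :: real) = (\<Sum>e\<in>T. 1)"
      using T finite_K by (intro sum.mono_neutral_cong_right) auto
    also have "\<dots> = real ((n - 1) choose (k - 1))" using card_K_containing[OF assms] by (simp add: T_def)
    finally show "p * (\<Sum>e\<in>K. (of_bool (e \<in> T))\<^sup>2) \<le> D" by (simp add: D_eq)
  qed (use finite_K p_nonneg p_le_1 D_ge_32 L_pos in auto)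
  also have "(D / L)\<^sup>2 / (4 * D) = D / (4 * L\<^sup>2)" using D_ge_32 L_pos by (simp add: field_simps power2_eq_square)
  then have "exp (- (D / L)\<^sup>2 / (4 * D)) \<le> exp (- 3 * L)" using deviation_exponent by simp
  finally have "measure_pmf.prob M {g. D + D / L \<le> F g} \<le> exp (- 3 * L)" by (simp add: EF)
  moreover have "measure_pmf.prob M {g. (1 + 1 / L) * D < real (card {e \<in> G g. v \<in> e})}
      \<le> measure_pmf.prob M {g. D + D / L \<le> F g}"
    unfolding F by (intro measure_pmf.finite_measure_mono) (auto simp: algebra_simps)
  ultimately show ?thesis by linarith
qed

lemma cover_G_fun_upd:
  assumes "e \<in> K"
  shows "cover (G (g(e := True))) A = cover (G (g(e := False))) A \<union> (if e \<inter> A \<noteq> {} then e else {})"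
  using assms by (auto simp: cover_def G_def split: if_splits)

lemma cover_G_subset: "cover (G g) A \<subseteq> V"
  by (auto simp: cover_def G_def K_def)

lemma finite_cover_G: "finite (cover (G g) A)"
  by (rule finite_subset[OF cover_G_subset finite_V])

text \<open>A vertex outside \<open>A\<close> is covered unless all its \<open>m\<close> potential
  edges meeting \<open>A\<close> are absent. The probability of being covered is at least
  \<open>m * p - (m * p) ^ 2 / 2\<close>, and \<open>m * p\<close> is estimated from both sides by
  the binomial bounds.\<close>

lemma expectation_cover_ge:
  assumes A: "A \<subseteq> V" "real (card A) * (real k * D) \<le> real n"
  shows "real (card A) * (real k * D) * (1 - real (card A) * (real k * D) / (2 * real n) - 1 / L)
    \<le> measure_pmf.expectation M (\<lambda>g. real (card (cover (G g) A)))"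
proof -
  define a where "a = card A"
  define q where "q = real a * (real k * D) / n"
  \<comment> \<open>\<open>D * (k - 1) / (n - 1)\<close> is the expected number of edges through two
    given vertices; \<open>h\<close> sums this over the pairs formed by a fixed outside vertex and
    the vertices of \<open>A\<close>.\<close>
  define h where "h = real a * D * (real k - 1) / (real n - 1)"
  have fin: "finite A" using A(1) finite_V by (rule finite_subset)
  have n0: "0 < real n" using n_ge by simp
  have q: "0 \<le> q" "q \<le> 1" using A(2) D_ge_32 n0 by (auto simp: q_def a_def)
  have kn: "real k \<le> real n" using k_le_n by simp
  have akn: "real a * real k / n \<le> 1 / D"
    using A(2) D_ge_32 n0 by (simp add: a_def field_simps)
  have D4: "1 / D \<le> 1 / (4 * L)"
  proof -
    have "4 * L * 1 \<le> 4 * L * L\<^sup>2" using L_ge one_le_power[of L 2] by (intro mult_left_mono) linarith+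
    also have "\<dots> = 4 * L ^ 3" by (simp add: power3_eq_cube power2_eq_square)
    also have "\<dots> \<le> D" using D_ge zero_le_power[of L 3] L_pos by linarith
    finally show ?thesis using L_pos by (simp add: frac_le)
  qed
  have L128: "1 / (4 * L) \<le> 1 / 128" using L_ge by (simp add: field_simps)
  have an: "real a / n \<le> real a * real k / n"
    using k_ge_128 n0 mult_left_mono[of 1 "real k" "real a"] by (intro divide_right_mono) auto
  then have "real a / n \<le> 1 / 128" using akn D4 L128 by linarith
  then have "real a \<le> n / 128" using n0 by (simp add: field_simps)
  then have a_less: "a < n - 1" using n_ge by linarith
  have h: "0 \<le> h" "h \<le> q"
  proof -
    have "(real k - 1) / (real n - 1) \<le> real k / real n"
      using kn n_ge by (simp add: field_simps)
    then have "real a * D * ((real k - 1) / (real n - 1)) \<le> real a * D * (real k / real n)"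
      using D_ge_32 by (intro mult_left_mono) auto
    then show "h \<le> q" by (simp add: h_def q_def mult_ac)
    show "0 \<le> h" using D_ge_32 k_ge_128 n_ge by (simp add: h_def)
  qed
  \<comment> \<open>A simpler lower bound for the correction factor that
    \<open>binomial_diff_ge\<close> supplies.\<close>
  define t where "t = 1 - real a * real k / n"
  have t: "0 \<le> t" using akn D4 L128 by (simp add: t_def)
  have pw: "h * t * (1 - q / 2) \<le> measure_pmf.prob M {g. v \<in> cover (G g) A}" if v: "v \<in> V - A" for v
  proof -
    define T where "T = {e \<in> K. v \<in> e \<and> e \<inter> A \<noteq> {}}"
    define m where "m = card T"
    define c where "c = real ((n - 1 - 1) choose (k - 1 - 1))"
    have T: "finite T" "T \<subseteq> K" using finite_K by (auto simp: T_def)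
    have "T = {e. e \<subseteq> V \<and> card e = k \<and> v \<in> e \<and> e \<inter> A \<noteq> {}}" by (auto simp: T_def K_def)
    then have m_nat: "m = ((n - 1) choose (k - 1)) - ((n - 1 - a) choose (k - 1))"
      unfolding m_def a_def using card_subsets_containing_meeting[OF finite_V A(1), of v k] v k_ge_128 card_V
      by simp
    have "(n - 1 - a) choose (k - 1) \<le> (n - 1) choose (k - 1)" by (intro binomial_right_mono) auto
    then have m: "real m = real ((n - 1) choose (k - 1)) - real ((n - 1 - a) choose (k - 1))"
      unfolding m_nat by (rule of_nat_diff)
    have pc: "real a * (p * c) = h"
    proof -
      have "real (n - 1) * c = real (k - 1) * real ((n - 1) choose (k - 1))"
        unfolding c_def using k_ge_128 by (intro real_binomial_absorb) auto
      then have "(real n - 1) * (p * c) = (real k - 1) * D"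
        using k_ge_128 n_ge by (simp add: D_eq of_nat_diff)
      then have "p * c = (real k - 1) * D / (real n - 1)" using n_ge by (simp add: field_simps)
      then show ?thesis by (simp add: h_def)
    qed
    have "m \<le> a * ((n - 1 - 1) choose (k - 1 - 1))"
      unfolding m_nat using binomial_diff_le[of "k - 1" a "n - 1"] k_ge_128 a_less by (simp add: le_diff_conv)
    then have "real m \<le> real a * c" unfolding c_def by (metis of_nat_le_iff of_nat_mult)
    then have "real m * p \<le> real a * c * p" using p_nonneg by (rule mult_right_mono)
    then have up: "real m * p \<le> h" using pc by (simp add: mult_ac)
    have "real a * c * (1 - real a * (real (k - 1) - 1) / (real (n - 1) - 1)) \<le> real m"
      unfolding m c_def using k_ge_128 a_less by (intro binomial_diff_ge) auto
    then have "real a * c * (1 - real a * (real (k - 1) - 1) / (real (n - 1) - 1)) * p \<le> real m * p"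
      using p_nonneg by (rule mult_right_mono)
    moreover have eq: "real a * c * w * p = h * w" for w using pc by (simp add: mult_ac)
    ultimately have "h * (1 - real a * (real (k - 1) - 1) / (real (n - 1) - 1)) \<le> real m * p"
      by (simp only: eq)
    moreover have "h * t \<le> h * (1 - real a * (real (k - 1) - 1) / (real (n - 1) - 1))"
    proof (rule mult_left_mono[OF _ h(1)])
      have "(real k - 2) / (real n - 2) \<le> real k / real n" using kn n_ge by (simp add: field_simps)
      then have "real a * ((real k - 2) / (real n - 2)) \<le> real a * (real k / real n)" by (intro mult_left_mono) auto
      then show "t \<le> 1 - real a * (real (k - 1) - 1) / (real (n - 1) - 1)"
        using k_ge_128 n_ge by (simp add: t_def of_nat_diff)
    qed
    ultimately have lo: "h * t \<le> real m * p" by linarith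
    \<comment> \<open>\<open>lo\<close> serves the first factor,
      \<open>m * p \<le> h \<le> q\<close> the second.\<close>
    have "h * t * (1 - q / 2) \<le> real m * p * (1 - real m * p / 2)"
      by (rule mult_mono[OF lo]) (use up h q p_nonneg in auto)
    also have "\<dots> = real m * p - (real m * p)\<^sup>2 / 2" by (simp add: power2_eq_square algebra_simps)
    also have "\<dots> \<le> 1 - (1 - p) ^ m" by (rule one_minus_power_le) (use p_nonneg p_le_1 in auto)
    also have "\<dots> = 1 - measure_pmf.prob M {g. \<forall>e\<in>T. \<not> g e}"
      using prob_bernoullis_all(2)[OF finite_K T(2) p_nonneg p_le_1] by (simp add: m_def)
    also have "\<dots> = measure_pmf.prob M (space M - {g. \<forall>e\<in>T. \<not> g e})"
      by (subst measure_pmf.prob_compl) auto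
    also have "space M - {g. \<forall>e\<in>T. \<not> g e} = {g. v \<in> cover (G g) A}"
      by (auto simp: T_def cover_def G_def)
    finally show ?thesis .
  qed
  \<comment> \<open>Four losses: \<open>1 / k\<close> as an edge reaches \<open>k - 1\<close>
    further vertices, \<open>a / n\<close> as vertices of \<open>A\<close> are not counted,
    \<open>a * k / n\<close> for edges meeting \<open>A\<close> repeatedly, and \<open>q / 2\<close>
    for vertices covered by several edges.\<close>
  have "real a * (real k * D) * (1 - 1 / k - a / n - real a * real k / n - q / 2)
    \<le> real a * (real k * D) * ((1 - 1 / k) * (1 - a / n) * t * (1 - q / 2))"
  proof (rule mult_left_mono)
    have prod2: "1 - (x + y) \<le> (1 - x) * (1 - y)" if "0 \<le> x" "0 \<le> y" for x y :: real
      using mult_nonneg_nonneg[OF that] by (simp add: algebra_simps)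
    have "(1 - (1 / k + a / n)) * (1 - (real a * real k / n + q / 2))
      \<le> ((1 - 1 / k) * (1 - a / n)) * ((1 - real a * real k / n) * (1 - q / 2))"
    proof (rule mult_mono)
      show "1 - (1 / k + a / n) \<le> (1 - 1 / k) * (1 - a / n)" by (rule prod2) auto
      show "1 - (real a * real k / n + q / 2) \<le> (1 - real a * real k / n) * (1 - q / 2)"
        using q by (intro prod2) auto
      have "1 / k \<le> 1" using k_ge_128 by simp
      moreover have "real a / n \<le> 1" using \<open>real a / n \<le> 1 / 128\<close> by linarith
      ultimately show "0 \<le> (1 - 1 / k) * (1 - a / n)" by simp
      show "0 \<le> 1 - (real a * real k / n + q / 2)" using akn D4 L128 q by linarith
    qed
    moreover have "1 - ((1 / k + a / n) + (real a * real k / n + q / 2))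
      \<le> (1 - (1 / k + a / n)) * (1 - (real a * real k / n + q / 2))"
      using q by (intro prod2) auto
    ultimately show "1 - 1 / k - a / n - real a * real k / n - q / 2 \<le> (1 - 1 / k) * (1 - a / n) * t * (1 - q / 2)"
      by (simp add: t_def mult.assoc)
    show "0 \<le> real a * (real k * D)" using D_ge_32 by simp
  qed
  also have "\<dots> = (real n - a) * (real a * D * (real k - 1) / n) * (t * (1 - q / 2))"
    using k_ge_128 n0 by (simp add: field_simps)
  also have "\<dots> \<le> (real n - a) * h * (t * (1 - q / 2))"
  proof (rule mult_right_mono[OF mult_left_mono])
    show "real a * D * (real k - 1) / n \<le> h"
      unfolding h_def using D_ge_32 k_ge_128 n_ge by (intro divide_left_mono) auto
  qed (use a_less t q in auto)
  also have "\<dots> = (\<Sum>v\<in>V - A. h * t * (1 - q / 2))"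
    using fin A(1) card_V card_mono[OF finite_V A(1)] by (simp add: card_Diff_subset a_def of_nat_diff)
  also have "\<dots> \<le> (\<Sum>v\<in>V - A. measure_pmf.prob M {g. v \<in> cover (G g) A})" by (intro sum_mono pw)
  also have "\<dots> \<le> (\<Sum>v\<in>V. measure_pmf.prob M {g. v \<in> cover (G g) A})"
    using finite_V by (intro sum_mono2) auto
  also have "\<dots> = measure_pmf.expectation M (\<lambda>g. real (card {v \<in> V. v \<in> cover (G g) A}))"
    by (rule expectation_card_filter[OF finite_V, symmetric])
  also have "(\<lambda>g. {v \<in> V. v \<in> cover (G g) A}) = (\<lambda>g. cover (G g) A)"
    using cover_G_subset by fast
  finally have main: "real a * (real k * D) * (1 - 1 / k - a / n - real a * real k / n - q / 2)
    \<le> measure_pmf.expectation M (\<lambda>g. real (card (cover (G g) A)))"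
    by (metis (no_types, lifting))
  \<comment> \<open>Three of the four losses are at most \<open>1 / (4 * L)\<close> each, together
    below \<open>1 / L\<close>.\<close>
  have "1 / k \<le> 1 / (4 * L)" using k_ge L_pos by (intro divide_left_mono) auto
  moreover have "3 * (1 / (4 * L)) \<le> 1 / L" using L_pos by (simp add: field_simps)
  ultimately have "1 - q / 2 - 1 / L \<le> 1 - 1 / k - a / n - real a * real k / n - q / 2"
    using akn D4 an by linarith
  then have "real a * (real k * D) * (1 - q / 2 - 1 / L)
      \<le> real a * (real k * D) * (1 - 1 / k - a / n - real a * real k / n - q / 2)"
    by (rule mult_left_mono) (use D_ge_32 in auto)
  also note main
  finally show ?thesis by (simp add: q_def a_def mult.commute[of 2])
qed

text \<open>At most \<open>card A * ((n - 1) choose (k - 1))\<close> potential edges matter, each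
  changing the cover by at most \<open>k\<close>, so the variance proxy is
  \<open>k ^ 2 * card A * D\<close>. The deviation \<open>card A * k * D / L\<close> adds the second
  \<open>1 / L\<close> to that of the mean.\<close>

lemma prob_small_cover:
  assumes A: "A \<subseteq> V" "A \<noteq> {}" "real (card A) * (real k * D) \<le> real n"
  shows "measure_pmf.prob M {g. real (card (cover (G g) A))
      < real (card A) * (real k * D) * (1 - real (card A) * (real k * D) / (2 * real n) - 2 / L)}
    \<le> exp (- 3 * L * card A)"
proof -
  define a where "a = real (card A)"
  define F where "F g = real (card (cover (G g) A))" for g
  define c where "c e = (if e \<inter> A \<noteq> {} then real k else 0)" for e :: "'a set"
  have a: "0 < a" using A finite_V by (auto simp: a_def card_gt_0_iff intro: finite_subset)
  have "measure_pmf.prob M {g. F g \<le> measure_pmf.expectation M F - a * (real k * D) / L}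
      \<le> exp (- (a * (real k * D) / L)\<^sup>2 / (4 * ((real k)\<^sup>2 * a * D)))"
  proof (rule bernoullis_lower_tail[where c = c])
    fix e g assume e: "e \<in> K"
    show "0 \<le> F (g(e := True)) - F (g(e := False))"
      unfolding F_def cover_G_fun_upd[OF e] using finite_cover_G e finite_V
      by (auto intro!: card_mono simp: K_def intro: finite_subset)
    have "card (cover (G (g(e := True))) A)
        \<le> card (cover (G (g(e := False))) A) + card (if e \<inter> A \<noteq> {} then e else {})"
      unfolding cover_G_fun_upd[OF e] by (rule card_Un_le)
    then show "F (g(e := True)) - F (g(e := False)) \<le> c e"
      using e by (auto simp: F_def c_def K_def split: if_splits)
  next
    have "(\<Sum>e\<in>K. (c e)\<^sup>2) = (\<Sum>e\<in>{e \<in> K. e \<inter> A \<noteq> {}}. (real k)\<^sup>2)"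
      using finite_K by (intro sum.mono_neutral_cong_right) (auto simp: c_def)
    also have "\<dots> = (real k)\<^sup>2 * real (card {e \<in> K. e \<inter> A \<noteq> {}})" by simp
    also have "\<dots> \<le> (real k)\<^sup>2 * real (card A * ((n - 1) choose (k - 1)))"
      by (intro mult_left_mono of_nat_mono card_K_meeting_le A) auto
    finally have "p * (\<Sum>e\<in>K. (c e)\<^sup>2) \<le> p * ((real k)\<^sup>2 * real (card A * ((n - 1) choose (k - 1))))"
      using p_nonneg by (rule mult_left_mono)
    then show "p * (\<Sum>e\<in>K. (c e)\<^sup>2) \<le> (real k)\<^sup>2 * a * D" by (simp add: a_def D_eq mult_ac)
  qed (use finite_K p_nonneg p_le_1 D_ge_32 k_ge_128 a L_pos in \<open>auto simp: c_def\<close>)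
  also have "\<dots> \<le> exp (- 3 * L * card A)"
  proof -
    have "(a * (real k * D) / L)\<^sup>2 / (4 * ((real k)\<^sup>2 * a * D)) = a * (D / (4 * L\<^sup>2))"
      using a D_ge_32 L_pos k_ge_128 by (simp add: field_simps power2_eq_square)
    moreover have "a * (3 * L) \<le> a * (D / (4 * L\<^sup>2))" using a deviation_exponent by (intro mult_left_mono) auto
    ultimately show ?thesis by (simp add: a_def mult_ac)
  qed
  finally have "measure_pmf.prob M {g. F g \<le> measure_pmf.expectation M F - a * (real k * D) / L}
    \<le> exp (- 3 * L * card A)" .
  moreover have "measure_pmf.prob M {g. F g < a * (real k * D) * (1 - a * (real k * D) / (2 * real n) - 2 / L)}
      \<le> measure_pmf.prob M {g. F g \<le> measure_pmf.expectation M F - a * (real k * D) / L}"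
  proof (intro measure_pmf.finite_measure_mono subsetI CollectI)
    fix g assume "g \<in> {g. F g < a * (real k * D) * (1 - a * (real k * D) / (2 * real n) - 2 / L)}"
    then have "F g < a * (real k * D) * (1 - a * (real k * D) / (2 * real n) - 2 / L)" by simp
    also have "\<dots> = a * (real k * D) * (1 - a * (real k * D) / (2 * real n) - 1 / L) - a * (real k * D) / L"
      by (simp add: algebra_simps)
    also have "\<dots> \<le> measure_pmf.expectation M F - a * (real k * D) / L"
      using expectation_cover_ge[OF A(1,3)] unfolding F_def a_def by simp
    finally show "F g \<le> measure_pmf.expectation M F - a * (real k * D) / L" by simp
  qed simp
  ultimately show ?thesis unfolding F_def a_def by linarith
qed

text \<open>First moment over all vertex sets \<open>S\<close> of size \<open>s\<close> and all
  choices of \<open>b\<close> potential edges inside \<open>S\<close>.\<close>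

lemma prob_clustered_edges:
  assumes b: "1 \<le> b" "b * k \<le> n"
  shows "measure_pmf.prob M {g. \<exists>B\<subseteq>G g. card B = b \<and> 10 * card (\<Union>B) < b * k} \<le> exp (- 2 * L)"
proof -
  define s where "s = b * k div 10"
  define T where "T S = {e. e \<subseteq> S \<and> card e = k}" for S :: "'a set"
  have s10: "10 * s \<le> b * k" by (simp add: s_def)
  then have sn: "s \<le> n" using b by linarith
  have n0: "0 < real n" using n_ge by simp
  let ?\<S> = "{S. S \<subseteq> V \<and> card S = s}"
  have fin\<S>: "finite ?\<S>" using finite_V by (auto intro: finite_subset[of _ "Pow V"])
  have finT: "finite (T S)" if "S \<in> ?\<S>" for S
    using that finite_V by (auto simp: T_def intro: finite_subset[of _ "Pow V"])
  have "{g. \<exists>B\<subseteq>G g. card B = b \<and> 10 * card (\<Union>B) < b * k}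
      \<subseteq> (\<Union>S\<in>?\<S>. \<Union>B\<in>{B. B \<subseteq> T S \<and> card B = b}. {g. \<forall>e\<in>B. g e})"
  proof
    fix g assume "g \<in> {g. \<exists>B\<subseteq>G g. card B = b \<and> 10 * card (\<Union>B) < b * k}"
    then obtain B where B: "B \<subseteq> G g" "card B = b" "10 * card (\<Union>B) < b * k" by blast
    have UV: "\<Union>B \<subseteq> V" using B(1) by (auto simp: G_def K_def)
    have "card (\<Union>B) \<le> s" using B(3) by (simp add: s_def)
    \<comment> \<open>Padding to exactly \<open>s\<close> vertices lets the union run over sets of a
      single size.\<close>
    then obtain S where S: "\<Union>B \<subseteq> S" "S \<subseteq> V" "card S = s"
      using exists_subset_between[of "\<Union>B" s V] UV finite_V sn card_V by auto
    then have "B \<subseteq> T S" "\<forall>e\<in>B. g e" using B(1) by (auto simp: T_def G_def K_def)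
    then show "g \<in> (\<Union>S\<in>?\<S>. \<Union>B\<in>{B. B \<subseteq> T S \<and> card B = b}. {g. \<forall>e\<in>B. g e})"
      using S B by blast
  qed
  then have "measure_pmf.prob M {g. \<exists>B\<subseteq>G g. card B = b \<and> 10 * card (\<Union>B) < b * k}
      \<le> measure_pmf.prob M (\<Union>S\<in>?\<S>. \<Union>B\<in>{B. B \<subseteq> T S \<and> card B = b}. {g. \<forall>e\<in>B. g e})"
    by (intro measure_pmf.finite_measure_mono) auto
  also have "\<dots> \<le> real (card ?\<S>) * (real ((s choose k) choose b) * p ^ b)"
  proof (rule prob_UN_le[OF fin\<S>])
    fix S assume S: "S \<in> ?\<S>"
    have "measure_pmf.prob M (\<Union>B\<in>{B. B \<subseteq> T S \<and> card B = b}. {g. \<forall>e\<in>B. g e})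
        \<le> real (card {B. B \<subseteq> T S \<and> card B = b}) * p ^ b"
    proof (rule prob_UN_le)
      show "finite {B. B \<subseteq> T S \<and> card B = b}" using finT[OF S] by (auto intro: finite_subset[of _ "Pow (T S)"])
      fix B assume "B \<in> {B. B \<subseteq> T S \<and> card B = b}"
      moreover from this have "B \<subseteq> K" using S unfolding T_def K_def by blast
      ultimately show "measure_pmf.prob M {g. \<forall>e\<in>B. g e} \<le> p ^ b"
        using prob_bernoullis_all(1)[OF finite_K _ p_nonneg p_le_1, of B] by simp
    qed
    also have "card {B. B \<subseteq> T S \<and> card B = b} = (card (T S) choose b)" by (rule n_subsets[OF finT[OF S]])
    also have "card (T S) = s choose k"
      unfolding T_def using n_subsets[of S k] S finite_V by (auto intro: finite_subset)
    finally show "measure_pmf.prob M (\<Union>B\<in>{B. B \<subseteq> T S \<and> card B = b}. {g. \<forall>e\<in>B. g e})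
        \<le> real ((s choose k) choose b) * p ^ b" .
  qed
  also have "card ?\<S> = n choose s" using n_subsets[OF finite_V, of s] card_V by simp
  also have "real ((s choose k) choose b) * p ^ b \<le> (exp (2 * L) * (real s / n) ^ k) ^ b"
  proof -
    have "((s choose k) choose b) * 1 \<le> ((s choose k) choose b) * fact b"
      by (intro mult_left_mono) auto
    also have "\<dots> \<le> (s choose k) ^ b" by (rule binomial_fact_pow)
    finally have "real ((s choose k) choose b) \<le> real (s choose k) ^ b"
      by (metis mult_1_right of_nat_le_iff of_nat_power)
    then have "real ((s choose k) choose b) * p ^ b \<le> real (s choose k) ^ b * p ^ b"
      using p_nonneg by (intro mult_right_mono) auto
    also have "\<dots> = (p * real (s choose k)) ^ b" by (simp add: power_mult_distrib mult.commute)
    also have "\<dots> \<le> (exp (2 * L) * (real s / n) ^ k) ^ b"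
    proof (rule power_mono)
      have "real n * real ((n - 1) choose (k - 1)) = real k * real (n choose k)"
        using k_ge_128 by (intro real_binomial_absorb) auto
      then have "real n * D = real k * (p * real (n choose k))" by (simp add: D_eq)
      then have pc: "p * real (n choose k) = real n * D / real k" using k_ge_128 by (simp add: field_simps)
      \<comment> \<open>The expected number of edges \<open>n * D / k\<close> is bounded crudely by
        \<open>n ^ 2\<close>; the resulting factor \<open>exp (2 * L)\<close> per edge is absorbed
        later through \<open>4 * L \<le> k\<close>.\<close>
      have "1 * D \<le> real k * D" using D_ge_32 k_ge_128 by (intro mult_right_mono) auto
      then have "D \<le> real n * 1" using R_le by linarith
      also have "\<dots> \<le> real n * real k" using k_ge_128 by (intro mult_left_mono) auto
      finally have "D / real k \<le> real n" using k_ge_128 by (simp add: field_simps)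
      then have "real n * (D / real k) \<le> real n * real n" by (intro mult_left_mono) auto
      also have "\<dots> = exp (2 * L)" by (simp add: n_eq[symmetric] flip: exp_add)
      finally have pc2: "p * real (n choose k) \<le> exp (2 * L)" using pc by simp
      have "p * real (s choose k) \<le> p * (real (n choose k) * (real s / n) ^ k)"
        using p_nonneg by (intro mult_left_mono binomial_le_ratio_power sn)
      also have "\<dots> = p * real (n choose k) * (real s / n) ^ k" by simp
      also have "\<dots> \<le> exp (2 * L) * (real s / n) ^ k" using pc2 by (intro mult_right_mono) auto
      finally show "p * real (s choose k) \<le> exp (2 * L) * (real s / n) ^ k" .
    qed (use p_nonneg in auto)
    finally show ?thesis .
  qed
  then have "real (n choose s) * (real ((s choose k) choose b) * p ^ b)
      \<le> real (n choose s) * (exp (2 * L) * (real s / n) ^ k) ^ b"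
    by (rule mult_left_mono) simp
  also have "(exp (2 * L) * (real s / n) ^ k) ^ b = exp (2 * L * b) * (real s / n) ^ (b * k)"
    by (simp add: power_mult_distrib exp_of_nat2_mult mult.commute[of b] flip: power_mult)
  \<comment> \<open>\<open>s\<close> of the factors are spent on cancelling
    \<open>n choose s\<close>; each of the others is at most \<open>1 / 10\<close>, hence at most
    \<open>exp (- 2)\<close>.\<close>
  also have "(real s / n) ^ (b * k) = (real s / n) ^ s * (real s / n) ^ (b * k - s)"
    using s10 by (simp flip: power_add)
  also have "real (n choose s) * (exp (2 * L * b) * ((real s / n) ^ s * (real s / n) ^ (b * k - s)))
      = (real (n choose s) * (real s / n) ^ s) * (real s / n) ^ (b * k - s) * exp (2 * L * b)"
    by (simp only: mult_ac)
  also have "\<dots> \<le> exp s * exp (- 2 * (real (b * k) - s)) * exp (2 * L * b)"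
  proof (intro mult_right_mono mult_mono)
    show "real (n choose s) * (real s / n) ^ s \<le> exp s" using n0 by (intro binomial_times_power_le_exp) auto
    have "exp (2::real) = exp 1 * exp 1" by (simp flip: exp_add)
    also have "\<dots> \<le> 3 * 3" by (intro mult_mono exp_le) auto
    finally have "1 / 10 \<le> exp (- 2 :: real)" by (simp add: exp_minus field_simps)
    moreover have "real s / n \<le> 1 / 10" using s10 b n0 by (simp add: field_simps)
    ultimately have "real s / n \<le> exp (- 2)" by linarith
    then have "(real s / n) ^ (b * k - s) \<le> exp (- 2) ^ (b * k - s)" by (rule power_mono) simp
    also have "\<dots> = exp (- 2 * (real (b * k) - s))"
      using s10 by (simp add: of_nat_diff mult.commute flip: exp_of_nat_mult)
    finally show "(real s / n) ^ (b * k - s) \<le> exp (- 2 * (real (b * k) - s))" .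
  qed auto
  also have "\<dots> = exp (3 * s - 2 * real (b * k) + 2 * L * b)" by (simp add: algebra_simps flip: exp_add)
  \<comment> \<open>Here \<open>3 * s\<close> is at most \<open>3 / 10\<close> and
    \<open>2 * L * b\<close> at most half of \<open>b * k\<close>, so the exponent is at most
    \<open>- 6 / 5 * b * k\<close>.\<close>
  also have "\<dots> \<le> exp (- 2 * L)"
  proof -
    have "10 * real s \<le> real (b * k)" using s10 by linarith
    moreover have "4 * L * b \<le> real (b * k)" using mult_right_mono[OF k_ge, of "real b"] by (simp add: mult_ac)
    moreover have "L * 1 \<le> L * b" using L_pos b by (intro mult_left_mono) auto
    ultimately show ?thesis by simp
  qed
  finally show ?thesis by simp
qed

text \<open>Each of three classes of failures has probability at most \<open>1 / n\<close>. The size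
  restrictions belong to the events themselves, so that the unions can run over all sizes in
  \<open>{1..n}\<close>.\<close>

lemma prob_expanding_ge:
  "1 - 3 / real n \<le> measure_pmf.prob M {g. expanding (exp (-8) / 1280) k V (G g)}"
proof -
  define bad1 where "bad1 v = {g. (1 + 1 / L) * D < real (card {e \<in> G g. v \<in> e})}" for v
  define bad2 where "bad2 A = {g. real (card A) * (real k * D) \<le> n \<and> real (card (cover (G g) A))
      < real (card A) * (real k * D) * (1 - real (card A) * (real k * D) / (2 * real n) - 2 / L)}" for A
  define bad3 where "bad3 b = {g. b * k \<le> n \<and> (\<exists>B\<subseteq>G g. card B = b \<and> 10 * card (\<Union>B) < b * k)}" for b
  let ?X1 = "\<Union>v\<in>V. bad1 v"
  let ?X2 = "\<Union>a\<in>{1..n}. \<Union>A\<in>{A. A \<subseteq> V \<and> card A = a}. bad2 A"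
  let ?X3 = "\<Union>b\<in>{1..n}. bad3 b"
  have n0: "0 < real n" using n_ge by simp
  have n2: "real n * exp (- 2 * L) = 1 / n"
    using n0 by (simp add: n_eq[symmetric] exp_minus field_simps flip: exp_add)
  have X1: "measure_pmf.prob M ?X1 \<le> 1 / n"
  proof -
    have "measure_pmf.prob M ?X1 \<le> real (card V) * exp (- 2 * L)"
    proof (rule prob_UN_le[OF finite_V])
      fix v assume "v \<in> V"
      then have "measure_pmf.prob M (bad1 v) \<le> exp (- 3 * L)" unfolding bad1_def by (rule prob_large_degree)
      also have "\<dots> \<le> exp (- 2 * L)" using L_pos by simp
      finally show "measure_pmf.prob M (bad1 v) \<le> exp (- 2 * L)" .
    qed
    then show ?thesis using n2 card_V by simp
  qed
  have X2: "measure_pmf.prob M ?X2 \<le> 1 / n"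
  proof -
    have "measure_pmf.prob M ?X2 \<le> real (card {1..n}) * exp (- 2 * L)"
    proof (rule prob_UN_le)
      fix a assume a: "a \<in> {1..n}"
      have "measure_pmf.prob M (\<Union>A\<in>{A. A \<subseteq> V \<and> card A = a}. bad2 A)
          \<le> real (card {A. A \<subseteq> V \<and> card A = a}) * exp (- 3 * L * a)"
      proof (rule prob_UN_le)
        show "finite {A. A \<subseteq> V \<and> card A = a}" using finite_V by (auto intro: finite_subset[of _ "Pow V"])
        fix A assume A: "A \<in> {A. A \<subseteq> V \<and> card A = a}"
        show "measure_pmf.prob M (bad2 A) \<le> exp (- 3 * L * a)"
        proof (cases "real (card A) * (real k * D) \<le> n")
          case True
          have "A \<noteq> {}" using A a by auto
          then show ?thesis unfolding bad2_def using prob_small_cover[of A] A True by simp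
        qed (simp add: bad2_def)
      qed
      also have "card {A. A \<subseteq> V \<and> card A = a} = n choose a" using n_subsets[OF finite_V] card_V by simp
      \<comment> \<open>There are at most \<open>n ^ a = exp (L * a)\<close> sets of size
        \<open>a\<close>.\<close>
      also have "real (n choose a) * exp (- 3 * L * a) \<le> real n ^ a * exp (- 3 * L * a)"
        using binomial_le_pow[of a n] a by (intro mult_right_mono) (auto simp flip: of_nat_power)
      also have "\<dots> = exp (- 2 * L * a)"
        by (simp add: n_eq[symmetric] algebra_simps flip: exp_of_nat_mult exp_add)
      also have "\<dots> \<le> exp (- 2 * L)" using a L_pos by simp
      finally show "measure_pmf.prob M (\<Union>A\<in>{A. A \<subseteq> V \<and> card A = a}. bad2 A) \<le> exp (- 2 * L)" .
    qed simp
    then show ?thesis using n2 by simp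
  qed
  have X3: "measure_pmf.prob M ?X3 \<le> 1 / n"
  proof -
    have "measure_pmf.prob M ?X3 \<le> real (card {1..n}) * exp (- 2 * L)"
    proof (rule prob_UN_le)
      fix b assume b: "b \<in> {1..n}"
      show "measure_pmf.prob M (bad3 b) \<le> exp (- 2 * L)"
      proof (cases "b * k \<le> n")
        case True
        then show ?thesis unfolding bad3_def using prob_clustered_edges[of b] b by simp
      qed (simp add: bad3_def)
    qed simp
    then show ?thesis using n2 by simp
  qed
  have good: "expanding (exp (-8) / 1280) k V (G g)" if g: "g \<notin> ?X1 \<union> ?X2 \<union> ?X3" for g
  proof -
    interpret tame_hypergraph k n D L V "G g"
    proof
      fix e assume "e \<in> G g"
      then show "e \<subseteq> V \<and> card e = k" by (simp add: G_def K_def)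
    next
      fix v assume "v \<in> V"
      then have "g \<notin> bad1 v" using g by blast
      then show "real (card {e \<in> G g. v \<in> e}) \<le> (1 + 1 / L) * D" by (simp add: bad1_def not_less)
    next
      fix A assume A: "A \<subseteq> V" "A \<noteq> {}" "real (card A) * (real k * D) \<le> real n"
      then have "card A \<in> {1..n}" using finite_V card_V card_mono[OF finite_V A(1)]
        by (auto simp: Suc_le_eq card_gt_0_iff intro: finite_subset)
      then have "g \<notin> bad2 A" using g A(1) by blast
      then show "real (card A) * (real k * D) * (1 - real (card A) * (real k * D) / (2 * real n) - 2 / L)
        \<le> real (card (cover (G g) A))" using A(3) by (simp add: bad2_def)
    next
      fix B assume B: "B \<subseteq> G g" "B \<noteq> {}" "card B * k \<le> n"
      have "finite B" using B(1) finite_K by (auto simp: G_def intro: finite_subset)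
      then have "1 \<le> card B" using B(2) by (simp add: Suc_le_eq card_gt_0_iff)
      moreover have "card B \<le> card B * k" using k_ge_128 by simp
      ultimately have "card B \<in> {1..n}" using B(3) unfolding atLeastAtMost_iff by linarith
      then have "g \<notin> bad3 (card B)" using g by blast
      then show "card B * k \<le> 10 * card (\<Union>B)" using B by (auto simp: bad3_def not_less)
    qed (fact finite_V card_V)+
    show ?thesis by (rule is_expanding)
  qed
  have "measure_pmf.prob M (?X1 \<union> ?X2 \<union> ?X3) \<le> measure_pmf.prob M (?X1 \<union> ?X2) + measure_pmf.prob M ?X3"
    by (rule measure_Un_le) auto
  also have "measure_pmf.prob M (?X1 \<union> ?X2) \<le> measure_pmf.prob M ?X1 + measure_pmf.prob M ?X2"
    by (rule measure_Un_le) auto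
  finally have "measure_pmf.prob M (?X1 \<union> ?X2 \<union> ?X3) \<le> 3 / n" using X1 X2 X3 by simp
  then have "1 - 3 / real n \<le> measure_pmf.prob M (space M - (?X1 \<union> ?X2 \<union> ?X3))"
    by (subst measure_pmf.prob_compl) auto
  also have "\<dots> \<le> measure_pmf.prob M {g. expanding (exp (-8) / 1280) k V (G g)}"
    using good by (intro measure_pmf.finite_measure_mono) auto
  finally show ?thesis .
qed

end

text \<open>Serves to derive \<open>p \<le> 1\<close> from the assumed upper bound
  \<open>n / k\<close> on \<open>p * ((n - 1) choose (k - 1))\<close>.\<close>

lemma n_over_k_le_binomial:
  assumes "2 \<le> k" "k \<le> n"
  shows "real n / real k \<le> real ((n - 1) choose (k - 1))"
proof -
  have 1: "1 \<le> real n / real k" using assms by (simp add: field_simps)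
  have "real n / real k \<le> (real n / real k) ^ (k - 1)"
    using assms power_increasing[of 1 "k - 1", OF _ 1] by simp
  also have "\<dots> \<le> (real (n - 1) / real (k - 1)) ^ (k - 1)"
    using assms by (intro power_mono) (auto simp: field_simps of_nat_diff)
  also have "\<dots> \<le> real ((n - 1) choose (k - 1))"
    using assms by (intro binomial_ge_n_over_k_pow_k) auto
  finally show ?thesis .
qed

theorem theorem1p7:
  "\<exists>\<xi>::real. 0 < \<xi> \<and>
     (\<forall>(k :: nat \<Rightarrow> nat) (p :: nat \<Rightarrow> real).
        (\<forall>\<^sub>F n in sequentially. 0 < p n) \<longrightarrow>
        (\<lambda>n. real (k n)) \<in> \<omega>(\<lambda>n. ln (real n)) \<longrightarrow>
        (\<forall>\<^sub>F n in sequentially. p n * real ((n - 1) choose (k n - 1)) \<le> real n / real (k n)) \<longrightarrow>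
        (\<lambda>n. p n * real ((n - 1) choose (k n - 1))) \<in> \<omega>(\<lambda>n. ln (real n) ^ 3) \<longrightarrow>
        (\<lambda>n. measure_pmf.prob (random_hypergraph (k n) n (p n))
               {E. expanding \<xi> (k n) {1..n} E}) \<longlonglongrightarrow> 1)"
proof (intro exI conjI allI impI)
  let ?\<xi> = "exp (-8) / 1280 :: real"
  show "0 < ?\<xi>" by simp
  fix k :: "nat \<Rightarrow> nat" and p :: "nat \<Rightarrow> real"
  assume p_pos: "\<forall>\<^sub>F n in sequentially. 0 < p n"
    and k_omega: "(\<lambda>n. real (k n)) \<in> \<omega>(\<lambda>n. ln (real n))"
    and upper: "\<forall>\<^sub>F n in sequentially. p n * real ((n - 1) choose (k n - 1)) \<le> real n / real (k n)"
    and D_omega: "(\<lambda>n. p n * real ((n - 1) choose (k n - 1))) \<in> \<omega>(\<lambda>n. ln (real n) ^ 3)"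
  have "\<forall>\<^sub>F n in sequentially. 1 - 3 / real n
      \<le> measure_pmf.prob (random_hypergraph (k n) n (p n)) {E. expanding ?\<xi> (k n) {1..n} E}"
    \<comment> \<open>The constants \<open>4\<close>, \<open>12\<close> and \<open>exp 32\<close>
      are those demanded by \<open>expansion_parameters\<close>.\<close>
    using p_pos smallomegaD[OF k_omega, of 4] upper smallomegaD[OF D_omega, of 12]
      eventually_ge_at_top[of "nat \<lceil>exp (32::real)\<rceil>"]
  proof eventually_elim
    fix n
    define L where "L = ln (real n)"
    define D where "D = p n * real ((n - 1) choose (k n - 1))"
    assume pn: "0 < p n" and kL: "4 * norm (ln (real n)) \<le> norm (real (k n))"
      and up: "p n * real ((n - 1) choose (k n - 1)) \<le> real n / real (k n)"
      and DL: "12 * norm (ln (real n) ^ 3) \<le> norm (p n * real ((n - 1) choose (k n - 1)))"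
      and n_large: "nat \<lceil>exp (32::real)\<rceil> \<le> n"
    have n32: "exp 32 \<le> real n" using n_large by linarith
    have n0: "0 < real n" using n32 exp_gt_zero[of "32::real"] by linarith
    have L: "32 \<le> L" using n32 n0 by (simp add: L_def ln_ge_iff)
    have k4: "4 * L \<le> real (k n)" using kL L by (simp add: L_def)
    have D12: "12 * L ^ 3 \<le> D" using DL L pn by (simp add: L_def D_def abs_mult power_abs)
    have kD: "real (k n) * D \<le> real n" using up k4 L by (simp add: D_def field_simps)
    have k2: "2 \<le> k n" using k4 L by linarith
    have "1 \<le> L ^ 3" by (rule one_le_power) (use L in simp)
    then have D1: "1 < D" using D12 by linarith
    have "real (k n) * 1 \<le> real (k n) * D" using D1 by (intro mult_left_mono) auto
    then have kn: "k n \<le> n" using kD by simp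
    have p1: "p n \<le> 1"
    proof -
      let ?c = "real ((n - 1) choose (k n - 1))"
      have "p n * ?c \<le> 1 * ?c" using up n_over_k_le_binomial[OF k2 kn] by linarith
      moreover have "0 < ?c" using kn k2 by simp
      ultimately show ?thesis by (simp only: mult_le_cancel_right)
    qed
    interpret random_k_graph "k n" n D L "{1..n}" "p n"
    proof
      show "exp L = real n" using n0 by (simp add: L_def)
    qed (use L D12 k4 kD pn p1 in \<open>auto simp: D_def\<close>)
    have "measure_pmf.prob (random_hypergraph (k n) n (p n)) {E. expanding ?\<xi> (k n) {1..n} E}
        = measure_pmf.prob M {g. expanding ?\<xi> (k n) {1..n} (G g)}"
      unfolding random_hypergraph_def Let_def K_def G_def by (simp add: vimage_def)
    then show "1 - 3 / real n
      \<le> measure_pmf.prob (random_hypergraph (k n) n (p n)) {E. expanding ?\<xi> (k n) {1..n} E}"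
      using prob_expanding_ge by simp
  qed
  moreover have "(\<lambda>n. 1 - 3 / real n) \<longlonglongrightarrow> 1"
    using tendsto_diff[OF tendsto_const[of 1] lim_const_over_n[of "3::real"]] by simp
  ultimately show "(\<lambda>n. measure_pmf.prob (random_hypergraph (k n) n (p n))
      {E. expanding ?\<xi> (k n) {1..n} E}) \<longlonglongrightarrow> 1"
    by - (rule tendsto_sandwich[where h = "\<lambda>_. 1" and f = "\<lambda>n. 1 - 3 / real n"], auto)
qed

end
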